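(* Fix integers $3\le r\le k$ and let $u(n)$ satisfy $u(n)\to\infty$, $u(n)/n\to0$. For any $\alpha\in(0,1)$ and any constant $\mu>\mu_{\mathrm c}(k,r):=\binom{k}{r}^{-1}\frac{(r-2)^{r-2}}{r(r-1)^{r-1}}$, the random bipartite graph with $m=\lfloor\mu n^{r-1}/u(n)^{r-2}\rfloor$ constraint vertices has no $\alpha$-large $(k-r+2)$-stopping set contained in $\{u(n)+1,\dots,n\}$ with probability at least $$1-\exp\Bigl\{\sup_{\tau>0}\inf_{\lambda<0}\varphi_{k,r}(\mu,\lambda,\tau)\,u(n)+O\bigl(\max\{u(n)^2/n,\ \log u(n)\}\bigr)\Bigr\}.$$
   Context: Random bipartite graph: variable vertices $[n]$, constraint vertices $[m]$; for each $a\in[m]$ independently, a $k$-tuple of pairwise distinct elements of $[n]$ is chosen uniformly among all $n(n-1)\cdots(n-k+1)$ such tuples, and $\partial(a)\subseteq[n]$ denotes the set of its entries. $d$-stopping set: a set $V'\subseteq[n]$ such that $|\partial(a)\cap V'|\notin\{1,2,\dots,d-1\}$ for every $a\in[m]$. For $\alpha\in(0,1)$, an $\alpha$-large $d$-stopping set is a nonempty $d$-stopping set of size at least $\alpha n$. $\varphi_{k,r}(\mu,\lambda,\tau):=\mu\bigl(e^{(k-r+1)\lambda}-1\bigr)\binom{k}{r-1}(1+\tau)^{r-1}-\lambda\tau$. *)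

theory Defs
  imports "HOL-Probability.Probability"
begin

text \<open>A bipartite graph with variable vertices {1..n} and constraint vertices {0..<m}
 (indexing of constraints is immaterial) is encoded by G, where G a i (i < k) is the
 i-th entry of the k-tuple of constraint a. Entries outside the range are fixed to 0.\<close>

definition graphs :: "nat \<Rightarrow> nat \<Rightarrow> nat \<Rightarrow> (nat \<Rightarrow> nat \<Rightarrow> nat) set" where
  "graphs n m k = {G. (\<forall>a<m. inj_on (G a) {..<k} \<and> G a ` {..<k} \<subseteq> {1..n})
                     \<and> (\<forall>a i. (m \<le> a \<or> k \<le> i) \<longrightarrow> G a i = 0)}"

text \<open>The random bipartite graph: each constraint independently picks a uniform
 k-tuple of distinct variables; equivalently, G is uniform on graphs n m k.\<close>
definition random_graph :: "nat \<Rightarrow> nat \<Rightarrow> nat \<Rightarrow> (nat \<Rightarrow> nat \<Rightarrow> nat) pmf" where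
  "random_graph n m k = pmf_of_set (graphs n m k)"

definition nbhd :: "nat \<Rightarrow> (nat \<Rightarrow> nat \<Rightarrow> nat) \<Rightarrow> nat \<Rightarrow> nat set" where
  "nbhd k G a = G a ` {..<k}"

definition stopping_set :: "nat \<Rightarrow> nat \<Rightarrow> (nat \<Rightarrow> nat \<Rightarrow> nat) \<Rightarrow> nat \<Rightarrow> nat set \<Rightarrow> bool" where
  "stopping_set m k G d V \<longleftrightarrow> V \<subseteq> {1..} \<and>
     (\<forall>a<m. card (nbhd k G a \<inter> V) \<notin> {1..d-1})"

definition large_stopping_set ::
  "nat \<Rightarrow> nat \<Rightarrow> nat \<Rightarrow> (nat \<Rightarrow> nat \<Rightarrow> nat) \<Rightarrow> real \<Rightarrow> nat \<Rightarrow> nat set \<Rightarrow> bool" where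
  "large_stopping_set n m k G \<alpha> d V \<longleftrightarrow>
     V \<subseteq> {1..n} \<and> V \<noteq> {} \<and> stopping_set m k G d V \<and> real (card V) \<ge> \<alpha> * real n"

definition phi :: "nat \<Rightarrow> nat \<Rightarrow> real \<Rightarrow> real \<Rightarrow> real \<Rightarrow> real" where
  "phi k r \<mu> lam \<tau> = \<mu> * (exp (real (k - r + 1) * lam) - 1) * real (k choose (r - 1)) * (1 + \<tau>) ^ (r - 1)
                     - lam * \<tau>"

definition mu_c :: "nat \<Rightarrow> nat \<Rightarrow> real" where
  "mu_c k r = (1 / real (k choose r)) * (real (r - 2) ^ (r - 2) / (real r * real (r - 1) ^ (r - 1)))"

end

theory Submission
  imports Defs
begin

text \<open>Call \<open>W\<close> closed if every constraint with at least \<open>r - 1\<close> entries in \<open>W\<close> lies inside \<open>W\<close>. The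
  complement of a \<open>(k - r + 2)\<close>-stopping set avoiding \<open>{1..u}\<close> is closed and contains \<open>{1..u}\<close>, so it
  suffices to bound the probability that the least closed set \<open>W\<close> containing \<open>{1..u}\<close> has size
  \<open>w = (1 + \<tau>) u\<close>, and to sum over \<open>w \<le> (1 - \<alpha>) n\<close>. Fix a set \<open>N \<supseteq> {1..u}\<close> of \<open>p\<close> vertices. On the event
  \<open>W \<subseteq> N\<close> the constraints inside \<open>N\<close> already determine \<open>W\<close>, and every other constraint must avoid
  having exactly \<open>r - 1\<close> entries in \<open>W\<close>. With \<open>p = exp \<lambda> n\<close> and \<open>\<lambda> < 0\<close> this costs a factor of about
  \<open>exp (u \<mu> (k choose (r - 1)) (1 + \<tau>)^(r - 1) (exp ((k - r + 1) \<lambda>) - 1))\<close>. Averaging over \<open>N\<close> removes the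
  condition \<open>W \<subseteq> N\<close> at the price of \<open>(n/p)^(u \<tau>) = exp (- u \<lambda> \<tau>)\<close>. The product is \<open>exp (u \<phi>(\<lambda>, \<tau>))\<close>.\<close>

section \<open>Tuples and closures\<close>

text \<open>Off \<open>{..<k}\<close> the entries are fixed to 0, as in \<open>graphs\<close>, so
  that a graph is an independent choice of \<open>m\<close> tuples and counts multiply over the
  constraints.\<close>

definition tuples :: "nat \<Rightarrow> nat set \<Rightarrow> (nat \<Rightarrow> nat) set" where
  "tuples k X = {f. inj_on f {..<k} \<and> f ` {..<k} \<subseteq> X \<and> (\<forall>i. k \<le> i \<longrightarrow> f i = 0)}"

text \<open>The falling factorial. Truncated subtraction makes it 0 when \<open>j\<close> exceeds
  \<open>N\<close>, so the counting formulas need no size conditions.\<close>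

definition ffact :: "nat \<Rightarrow> nat \<Rightarrow> nat" where
  "ffact N j = (\<Prod>i<j. N - i)"

lemma ffact_0 [simp]: "ffact N 0 = 1"
  by (simp add: ffact_def)

lemma ffact_Suc: "ffact N (Suc j) = ffact N j * (N - j)"
  by (simp add: ffact_def)

lemma graphs_eq_PiE_dflt: "graphs n m k = PiE_dflt {..<m} (\<lambda>_. 0) (\<lambda>_. tuples k {1..n})"
  by (auto simp: graphs_def PiE_dflt_def tuples_def fun_eq_iff)

lemma tuples_0: "tuples 0 X = {\<lambda>_. 0}"
  by (auto simp: tuples_def)

lemma tuples_Suc_cases:
  assumes "f \<in> tuples (Suc k) X"
  obtains g x where "g \<in> tuples k X" "x \<in> X - g ` {..<k}" "f = g(k := x)"
proof
  show "f(k := 0) \<in> tuples k X"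
    using assms by (auto simp: tuples_def inj_on_def lessThan_Suc)
  show "f k \<in> X - f(k := 0) ` {..<k}"
    using assms by (auto simp: tuples_def inj_on_def lessThan_Suc)
  show "f = (f(k := 0))(k := f k)" by simp
qed

lemma tuples_upd:
  assumes "g \<in> tuples k X" "x \<in> X - g ` {..<k}"
  shows "g(k := x) \<in> tuples (Suc k) X" and "(g(k := x)) ` {..<Suc k} = insert x (g ` {..<k})"
proof -
  show im: "(g(k := x)) ` {..<Suc k} = insert x (g ` {..<k})"
    by (auto simp: lessThan_Suc)
  have "inj_on (g(k := x)) {..<Suc k}"
    using assms by (auto simp: tuples_def inj_on_def lessThan_Suc)
  moreover have "(g(k := x)) ` {..<Suc k} \<subseteq> X"
    using assms unfolding im by (auto simp: tuples_def)
  ultimately show "g(k := x) \<in> tuples (Suc k) X"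
    using assms unfolding tuples_def by auto
qed

lemma tuples_upd_inj:
  assumes "g \<in> tuples k X" "g' \<in> tuples k X" "g(k := x) = g'(k := x')"
  shows "g = g' \<and> x = x'"
proof
  show "g = g'"
  proof
    fix i show "g i = g' i"
      using assms by (cases "i = k") (auto simp: tuples_def fun_eq_iff dest: spec[of _ i])
  qed
  show "x = x'" using fun_cong[OF assms(3), of k] by simp
qed

lemma finite_tuples: "finite X \<Longrightarrow> finite (tuples k X)"
proof (induction k)
  case 0
  then show ?case by (simp add: tuples_0)
next
  case (Suc k)
  have "tuples (Suc k) X \<subseteq> (\<lambda>(g, x). g(k := x)) ` (tuples k X \<times> X)"
    by (auto elim!: tuples_Suc_cases)
  with Suc show ?case by (meson finite_SigmaI finite_imageI finite_subset)
qed

text \<open>Choose the \<open>s\<close> positions with entries in \<open>W\<close>, fill them from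
  \<open>W\<close> and the others from \<open>X - W\<close>. The induction appends the last entry,
  outside \<open>W\<close> (\<open>A\<close>) or inside it (\<open>B\<close>); Pascal's rule
  combines the two counts.\<close>

lemma card_tuples_meet:
  assumes fin: "finite X" and W: "W \<subseteq> X"
  shows "card {f \<in> tuples k X. card (f ` {..<k} \<inter> W) = s} =
    (k choose s) * ffact (card W) s * ffact (card X - card W) (k - s)"
proof (induction k arbitrary: s)
  case 0
  have "{f \<in> tuples 0 X. card (f ` {..<0} \<inter> W) = s} = (if s = 0 then {\<lambda>_. 0} else {})"
    by (auto simp: tuples_0)
  then show ?case by simp
next
  case (Suc k)
  define M where "M s = {f \<in> tuples k X. card (f ` {..<k} \<inter> W) = s}" for s
  define ext where "ext = (\<lambda>(g :: nat \<Rightarrow> nat, x :: nat). g(k := x))"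
  define A where "A = (SIGMA g:M s. (X - W) - g ` {..<k})"
  \<comment> \<open>The guard \<open>0 < s\<close> excludes the case in which \<open>s - 1\<close>
    is truncated.\<close>
  define B where "B = (SIGMA g:{g. 0 < s \<and> g \<in> M (s - 1)}. W - g ` {..<k})"
  have finW: "finite W" using fin W by (rule finite_subset[rotated])
  have finM: "finite (M s)" for s
    unfolding M_def using finite_tuples[OF fin] by simp
  have card_im: "card (g ` {..<k}) = k" "g ` {..<k} \<subseteq> X" if "g \<in> tuples k X" for g
    using that by (auto simp: tuples_def card_image)
  have "{f \<in> tuples (Suc k) X. card (f ` {..<Suc k} \<inter> W) = s} = ext ` (A \<union> B)"
  proof (intro equalityI subsetI)
    fix f assume f: "f \<in> {f \<in> tuples (Suc k) X. card (f ` {..<Suc k} \<inter> W) = s}"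
    then obtain g x where g: "g \<in> tuples k X" "x \<in> X - g ` {..<k}" "f = g(k := x)"
      by (auto elim: tuples_Suc_cases)
    have im: "f ` {..<Suc k} = insert x (g ` {..<k})"
      using tuples_upd(2)[OF g(1,2)] g(3) by simp
    have "(g, x) \<in> A \<union> B"
    proof (cases "x \<in> W")
      case True
      then have "insert x (g ` {..<k}) \<inter> W = insert x (g ` {..<k} \<inter> W)" by auto
      moreover have "s = card (insert x (g ` {..<k}) \<inter> W)" using f unfolding mem_Collect_eq im by argo
      ultimately have "s = Suc (card (g ` {..<k} \<inter> W))"
        using g(2) by simp
      then show ?thesis using True g by (auto simp: B_def M_def)
    next
      case False
      then have "insert x (g ` {..<k}) \<inter> W = g ` {..<k} \<inter> W" by auto
      then have "s = card (g ` {..<k} \<inter> W)" using f unfolding mem_Collect_eq im by argo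
      then show ?thesis using False g by (auto simp: A_def M_def)
    qed
    then show "f \<in> ext ` (A \<union> B)" using g(3) by (force simp: ext_def)
  next
    fix f assume "f \<in> ext ` (A \<union> B)"
    then obtain g x where gx: "(g, x) \<in> A \<union> B" "f = g(k := x)"
      by (auto simp: ext_def)
    then have g: "g \<in> tuples k X" "x \<in> X - g ` {..<k}"
      using W by (auto simp: A_def B_def M_def)
    note u = tuples_upd[OF g, folded gx(2)]
    have "card (f ` {..<Suc k} \<inter> W) = s"
    proof (cases "x \<in> W")
      case True
      then have "insert x (g ` {..<k}) \<inter> W = insert x (g ` {..<k} \<inter> W)" by auto
      moreover have "s = Suc (card (g ` {..<k} \<inter> W))"
        using True gx by (auto simp: A_def B_def M_def)
      ultimately show ?thesis using u g by simp
    next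
      case False
      then have "insert x (g ` {..<k}) \<inter> W = g ` {..<k} \<inter> W" by auto
      then show ?thesis using False gx u by (auto simp: A_def B_def M_def)
    qed
    then show "f \<in> {f \<in> tuples (Suc k) X. card (f ` {..<Suc k} \<inter> W) = s}"
      using u by simp
  qed
  moreover have "inj_on ext (A \<union> B)"
    by (rule inj_onI) (auto simp: ext_def A_def B_def M_def dest: tuples_upd_inj)
  moreover have "A \<inter> B = {}" by (auto simp: A_def B_def)
  moreover have "finite A" "finite B"
    unfolding A_def B_def using fin finW finM by (auto intro!: finite_SigmaI)
  ultimately have "card {f \<in> tuples (Suc k) X. card (f ` {..<Suc k} \<inter> W) = s} = card A + card B"
    by (simp add: card_image card_Un_disjoint)
  moreover have "card A = card (M s) * (card X - card W - (k - s))"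
  proof -
    have "card ((X - W) - g ` {..<k}) = card X - card W - (k - s)" if "g \<in> M s" for g
    proof -
      have g: "g \<in> tuples k X" "card (g ` {..<k} \<inter> W) = s" using that by (auto simp: M_def)
      have "(X - W) - g ` {..<k} = (X - W) - (g ` {..<k} - W)" by auto
      also have "card \<dots> = card (X - W) - card (g ` {..<k} - W)"
        using card_im[OF g(1)] by (intro card_Diff_subset) auto
      also have "card (X - W) = card X - card W"
        using finW W by (rule card_Diff_subset)
      also have "card (g ` {..<k} - W) = k - s"
        using g card_im[OF g(1)] by (simp add: card_Diff_subset_Int)
      finally show ?thesis .
    qed
    then show ?thesis unfolding A_def using finM fin by simp
  qed
  moreover have "card B = (if s = 0 then 0 else card (M (s - 1)) * (card W - (s - 1)))"
  proof -
    have "card (W - g ` {..<k}) = card W - (s - 1)" if "g \<in> M (s - 1)" for g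
    proof -
      have "card (g ` {..<k} \<inter> W) = s - 1" using that by (auto simp: M_def)
      then show ?thesis by (simp add: card_Diff_subset_Int Int_commute)
    qed
    then show ?thesis unfolding B_def using finM finW by auto
  qed
  moreover note Suc.IH[folded M_def]
  ultimately have *: "card {f \<in> tuples (Suc k) X. card (f ` {..<Suc k} \<inter> W) = s} =
     (k choose s) * ffact (card W) s * ffact (card X - card W) (k - s) * (card X - card W - (k - s)) +
     (if s = 0 then 0 else (k choose (s - 1)) * ffact (card W) (s - 1) *
        ffact (card X - card W) (k - (s - 1)) * (card W - (s - 1)))"
    by simp
  show ?case
  proof (cases s)
    case 0
    then show ?thesis using * by (simp add: ffact_Suc)
  next
    case (Suc s')
    define p q where "p = k choose s'" and "q = k choose s"
    define x y where "x = ffact (card W) s'" and "y = ffact (card X - card W) (k - s')"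
    define c where "c = card W - s'"
    have "ffact (card X - card W) (k - s) * (card X - card W - (k - s)) = y" if "s \<le> k"
    proof -
      have "k - s' = Suc (k - s)" using Suc that by simp
      then show ?thesis by (simp add: y_def ffact_Suc)
    qed
    \<comment> \<open>For \<open>s > k\<close> the preceding identity may fail because
      \<open>k - s\<close> is truncated, but then \<open>q\<close> is 0.\<close>
    then have "q * (ffact (card X - card W) (k - s) * (card X - card W - (k - s))) = q * y"
      by (cases "s \<le> k") (auto simp: q_def)
    moreover have "ffact (card W) s = x * c" "Suc k choose s = p + q" "Suc k - s = k - s'"
      using Suc by (simp_all add: x_def c_def ffact_Suc p_def q_def)
    moreover have "card {f \<in> tuples (Suc k) X. card (f ` {..<Suc k} \<inter> W) = s} =
        ffact (card W) s * (q * (ffact (card X - card W) (k - s) * (card X - card W - (k - s)))) + p * x * y * c"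
      using * Suc unfolding p_def q_def x_def y_def c_def by (simp only: mult_ac) simp
    ultimately show ?thesis
by (simp add: algebra_simps y_def)
  qed
qed

lemma card_tuples: "finite X \<Longrightarrow> card (tuples k X) = ffact (card X) k"
  using card_tuples_meet[of X "{}" k 0] by simp

section \<open>Closures of a family of edges\<close>

text \<open>For finite edges this is the final set of a percolation started from \<open>U\<close>,
  where an edge with at least \<open>s\<close> infected points becomes wholly infected. The
  intersection form avoids speaking of rounds.\<close>

definition least_closed :: "nat \<Rightarrow> nat set set \<Rightarrow> nat set \<Rightarrow> nat set" where
  "least_closed s F U = \<Inter>{W. U \<subseteq> W \<and> (\<forall>e\<in>F. s \<le> card (e \<inter> W) \<longrightarrow> e \<subseteq> W)}"

lemma least_closed_superset: "U \<subseteq> least_closed s F U"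
  by (auto simp: least_closed_def)

lemma least_closed_least:
  "U \<subseteq> W \<Longrightarrow> (\<And>e. e \<in> F \<Longrightarrow> s \<le> card (e \<inter> W) \<Longrightarrow> e \<subseteq> W) \<Longrightarrow> least_closed s F U \<subseteq> W"
  by (auto simp: least_closed_def)

text \<open>For finite \<open>e\<close> the number of points of \<open>e\<close> in a set is
  monotone in that set, so an edge triggered by the intersection is triggered by every closed
  superset of \<open>U\<close>.\<close>

lemma least_closed_closed:
  assumes "e \<in> F" "finite e" "s \<le> card (e \<inter> least_closed s F U)"
  shows "e \<subseteq> least_closed s F U"
proof -
  have "e \<subseteq> W" if "U \<subseteq> W" "\<forall>e\<in>F. s \<le> card (e \<inter> W) \<longrightarrow> e \<subseteq> W" for W
  proof -
    have "least_closed s F U \<subseteq> W" using that by (intro least_closed_least) auto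
    then have "card (e \<inter> least_closed s F U) \<le> card (e \<inter> W)"
      using assms by (intro card_mono) auto
    then show ?thesis using assms that by auto
  qed
  then show ?thesis by (auto simp: least_closed_def)
qed

text \<open>Only the edges inside the closure matter for generating it.\<close>
lemma least_closed_subfamily:
  assumes "F' \<subseteq> F" and "\<And>e. e \<in> F \<Longrightarrow> finite e"
    and "\<And>e. e \<in> F \<Longrightarrow> e \<subseteq> least_closed s F U \<Longrightarrow> e \<in> F'"
  shows "least_closed s F' U = least_closed s F U"
proof
  show "least_closed s F' U \<subseteq> least_closed s F U"
    using assms least_closed_closed[of _ F s U] least_closed_superset[of U s F]
    by (intro least_closed_least) blast+
  show "least_closed s F U \<subseteq> least_closed s F' U"
  proof -
    let ?W = "least_closed s F U" and ?W' = "least_closed s F' U"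
    \<comment> \<open>The intersection is closed under \<open>F\<close>: an edge of \<open>F\<close>
      with \<open>s\<close> points in it is contained in \<open>?W\<close>, hence belongs to
      \<open>F'\<close>, hence is contained in \<open>?W'\<close>.\<close>
    have "?W \<subseteq> ?W \<inter> ?W'"
    proof (rule least_closed_least)
      show "U \<subseteq> ?W \<inter> ?W'" by (simp add: least_closed_superset)
      fix e assume e: "e \<in> F" "s \<le> card (e \<inter> (?W \<inter> ?W'))"
      have "card (e \<inter> (?W \<inter> ?W')) \<le> card (e \<inter> ?W)" "card (e \<inter> (?W \<inter> ?W')) \<le> card (e \<inter> ?W')"
        using assms(2)[OF e(1)] by (auto intro!: card_mono)
      then have "s \<le> card (e \<inter> ?W)" "s \<le> card (e \<inter> ?W')" using e by auto
      then show "e \<subseteq> ?W \<inter> ?W'"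
        using assms e least_closed_closed[of e F s U] least_closed_closed[of e F' s U] by blast
    qed
    then show ?thesis by blast
  qed
qed

text \<open>\<open>s\<close> is the threshold, \<open>r - 1\<close> in the theorem.\<close>
definition wet :: "nat \<Rightarrow> nat \<Rightarrow> nat \<Rightarrow> nat set \<Rightarrow> (nat \<Rightarrow> nat \<Rightarrow> nat) \<Rightarrow> nat set" where
  "wet m k s U G = least_closed s (nbhd k G ` {..<m}) U"

section \<open>Counting graphs with a closure of given size\<close>

lemma finite_nbhd [simp]: "finite (nbhd k G a)"
  by (simp add: nbhd_def)

lemma tuples_mono_iff: "N \<subseteq> X \<Longrightarrow> f \<in> tuples k N \<longleftrightarrow> f \<in> tuples k X \<and> f ` {..<k} \<subseteq> N"
  by (auto simp: tuples_def)

text \<open>Removing these two classes from all tuples over \<open>X\<close> leaves the tuples not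
  inside \<open>N\<close> that meet \<open>W\<close> in exactly \<open>s\<close> points. Their
  number is a difference of two values of \<open>card_tuples_meet\<close>, one for \<open>X\<close>
  and one for \<open>N\<close>.\<close>

lemma card_tuples_avoid:
  assumes N: "N \<subseteq> X" and X: "finite X" and W: "W \<subseteq> N"
  shows "card (tuples k N) + card {f \<in> tuples k X. \<not> f ` {..<k} \<subseteq> N \<and> card (f ` {..<k} \<inter> W) \<noteq> s}
    = ffact (card X) k - (k choose s) * ffact (card W) s *
        (ffact (card X - card W) (k - s) - ffact (card N - card W) (k - s))"
proof -
  let ?meet = "\<lambda>f :: nat \<Rightarrow> nat. card (f ` {..<k} \<inter> W) = s"
  let ?A = "{f \<in> tuples k X. \<not> f ` {..<k} \<subseteq> N \<and> \<not> ?meet f}"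
  let ?B = "{f \<in> tuples k X. \<not> f ` {..<k} \<subseteq> N \<and> ?meet f}"
  have fN: "finite N" using N X by (rule finite_subset)
  note fin = finite_tuples[OF X, of k] finite_tuples[OF fN, of k]
  have "card (tuples k X) = card (tuples k N \<union> ?A \<union> ?B)"
    by (rule arg_cong[of _ _ card]) (auto simp: tuples_mono_iff[OF N])
  also have "\<dots> = card (tuples k N) + card ?A + card ?B"
    using fin by (subst card_Un_disjoint; (subst card_Un_disjoint)?) (auto simp: tuples_mono_iff[OF N] image_subset_iff)
  finally have T: "ffact (card X) k = card (tuples k N) + card ?A + card ?B"
    by (simp add: card_tuples X)
  have "card {f \<in> tuples k X. ?meet f} = card (?B \<union> {f \<in> tuples k N. ?meet f})"
    by (rule arg_cong[of _ _ card]) (auto simp: tuples_mono_iff[OF N])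
  also have "\<dots> = card ?B + card {f \<in> tuples k N. ?meet f}"
    using fin by (intro card_Un_disjoint) (auto simp: tuples_mono_iff[OF N])
  finally have "card ?B = (k choose s) * ffact (card W) s * ffact (card X - card W) (k - s)
      - (k choose s) * ffact (card W) s * ffact (card N - card W) (k - s)"
    using N W by (simp add: card_tuples_meet X fN)
  with T show ?thesis by (simp add: diff_mult_distrib2)
qed

lemma nbhd_subset: "G \<in> graphs n m k \<Longrightarrow> a < m \<Longrightarrow> nbhd k G a \<subseteq> {1..n}"
  by (auto simp: graphs_def nbhd_def)

lemma wet_superset: "U \<subseteq> wet m k s U G"
  by (simp add: wet_def least_closed_superset)

lemma wet_subset: "G \<in> graphs n m k \<Longrightarrow> U \<subseteq> {1..n} \<Longrightarrow> wet m k s U G \<subseteq> {1..n}"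
  unfolding wet_def using nbhd_subset by (intro least_closed_least) blast+

text \<open>First reveal which edges lie inside \<open>N\<close>, and these edges: they determine the closure \<open>W\<close>.
  Each of the remaining edges then has to avoid meeting \<open>W\<close> in exactly \<open>s\<close> points, and the
  number of choices for it depends on \<open>W\<close> only through \<open>card W\<close>.\<close>
lemma card_wet_subset_le:
  assumes N: "N \<subseteq> {1..n}"
  shows "card {G \<in> graphs n m k. wet m k s U G \<subseteq> N \<and> card (wet m k s U G) = w} \<le>
    (ffact n k - (k choose s) * ffact w s * (ffact (n - w) (k - s) - ffact (card N - w) (k - s))) ^ m"
proof -
  define E where "E = {G \<in> graphs n m k. wet m k s U G \<subseteq> N \<and> card (wet m k s U G) = w}"
  define Q where "Q W = {f \<in> tuples k {1..n}. \<not> f ` {..<k} \<subseteq> N \<and> card (f ` {..<k} \<inter> W) \<noteq> s}" for W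
  define D where "D = ffact n k - (k choose s) * ffact w s * (ffact (n - w) (k - s) - ffact (card N - w) (k - s))"
  define b where "b = D - card (tuples k N)"
  have fN: "finite N" using N finite_subset by blast
  have Q: "card (tuples k N) + card (Q W) = D" if "W \<subseteq> N" "card W = w" for W
    using card_tuples_avoid[OF N _ that(1), of k s] that(2) by (simp add: Q_def D_def)
  have finQ: "finite (Q W)" for W
    using finite_tuples[of "{1..n}" k] by (simp add: Q_def)
  \<comment> \<open>\<open>cl S g\<close> uses only the revealed edges, indexed by \<open>S\<close>
    and given by \<open>g\<close>. \<open>Z S g\<close> fixes these and restricts every other edge
    to \<open>Q\<close>.\<close>
  define cl where "cl S g = least_closed s (nbhd k g ` S) U" for S and g :: "nat \<Rightarrow> nat \<Rightarrow> nat"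
  define Z where "Z S g = (if cl S g \<subseteq> N \<and> card (cl S g) = w
      then PiE_dflt {..<m} (\<lambda>_. 0) (\<lambda>a. if a \<in> S then {g a} else Q (cl S g)) else {})" for S g
  define P where "P S = PiE_dflt S (\<lambda>_. 0 :: nat) (\<lambda>_. tuples k N)" for S :: "nat set"
  have "E \<subseteq> (\<Union>S\<in>Pow {..<m}. \<Union>g\<in>P S. Z S g)"
  proof
    fix G assume "G \<in> E"
    then have G: "G \<in> graphs n m k" "wet m k s U G \<subseteq> N" "card (wet m k s U G) = w"
      by (auto simp: E_def)
    define S where "S = {a. a < m \<and> nbhd k G a \<subseteq> N}"
    define g where "g = (\<lambda>a. if a \<in> S then G a else (\<lambda>_. 0))"
    have Ga: "G a \<in> tuples k {1..n}" if "a < m" for a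
      using G(1) that by (auto simp: graphs_eq_PiE_dflt PiE_dflt_def)
    have "cl S g = cl S G"
      unfolding cl_def by (intro arg_cong2[of _ _ _ _ "least_closed s"] image_cong)
        (auto simp: g_def nbhd_def)
    also have "\<dots> = wet m k s U G"
      unfolding cl_def wet_def
      using G(2) by (intro least_closed_subfamily) (auto simp: S_def wet_def)
    finally have cl: "cl S g = wet m k s U G" .
    have "G a \<in> Q (cl S g)" if a: "a < m" "a \<notin> S" for a
    proof -
      have "\<not> nbhd k G a \<subseteq> N" using a by (simp add: S_def)
      then have "\<not> nbhd k G a \<subseteq> cl S g" using cl G by blast
      then have "\<not> s \<le> card (nbhd k G a \<inter> cl S g)"
        using least_closed_closed[of "nbhd k G a" "nbhd k G ` {..<m}" s U] a
        by (auto simp: cl wet_def)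
      \<comment> \<open>Fewer than \<open>s\<close> points is stronger, but excluding the value
        \<open>s\<close> alone already yields the rate.\<close>
      then have "card (nbhd k G a \<inter> cl S g) \<noteq> s" by linarith
      then show ?thesis using Ga[OF a(1)] \<open>\<not> nbhd k G a \<subseteq> N\<close> by (simp add: Q_def nbhd_def)
    qed
    moreover have "G a = (\<lambda>_. 0)" if "\<not> a < m" for a
      using G(1) that by (auto simp: graphs_def fun_eq_iff)
    ultimately have "G \<in> Z S g"
      using cl G by (auto simp: Z_def PiE_dflt_def g_def)
    moreover have "g \<in> P S"
      using Ga by (auto simp: P_def PiE_dflt_def g_def S_def tuples_mono_iff[OF N] nbhd_def)
    moreover have "S \<in> Pow {..<m}" by (auto simp: S_def)
    ultimately show "G \<in> (\<Union>S\<in>Pow {..<m}. \<Union>g\<in>P S. Z S g)" by blast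
  qed
  moreover have finP: "finite (P S)" if "S \<subseteq> {..<m}" for S
    unfolding P_def using that finite_tuples[OF fN] by (intro finite_PiE_dflt) (auto intro: finite_subset)
  moreover have finZ: "finite (Z S g)" for S g
    unfolding Z_def using finQ by (auto intro!: finite_PiE_dflt)
  ultimately have "card E \<le> card (\<Union>S\<in>Pow {..<m}. \<Union>g\<in>P S. Z S g)"
    by (intro card_mono) auto
  also have "\<dots> \<le> (\<Sum>S\<in>Pow {..<m}. \<Sum>g\<in>P S. card (Z S g))"
    by (intro order.trans[OF card_UN_le] sum_mono card_UN_le) (auto simp: finP)
  also have "\<dots> \<le> (\<Sum>S\<in>Pow {..<m}. \<Sum>g\<in>P S. \<Prod>a\<in>{..<m} - S. b)"
  proof (intro sum_mono)
    fix S g assume S: "S \<in> Pow {..<m}"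
    show "card (Z S g) \<le> (\<Prod>a\<in>{..<m} - S. b)"
    proof (cases "cl S g \<subseteq> N \<and> card (cl S g) = w")
      case True
      then have "card (Z S g) = (\<Prod>a<m. card (if a \<in> S then {g a} else Q (cl S g)))"
        unfolding Z_def using finQ by (simp add: card_PiE_dflt)
      also have "\<dots> = (\<Prod>a\<in>{..<m} - S. card (Q (cl S g)))"
        by (rule prod.mono_neutral_cong_right) auto
      also have "card (Q (cl S g)) = b"
        using Q[of "cl S g"] True by (simp add: b_def)
      finally show ?thesis by simp
    qed (auto simp: Z_def)
  qed
  also have "\<dots> = (\<Sum>S\<in>Pow {..<m}. (\<Prod>a\<in>S. card (tuples k N)) * (\<Prod>a\<in>{..<m} - S. b))"
  proof (intro sum.cong refl)
    fix S assume "S \<in> Pow {..<m}"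
    then have "finite S" using finite_subset by blast
    then have "card (P S) = (\<Prod>a\<in>S. card (tuples k N))"
      unfolding P_def using finite_tuples[OF fN] by (intro card_PiE_dflt)
    then show "(\<Sum>g\<in>P S. \<Prod>a\<in>{..<m} - S. b) = (\<Prod>a\<in>S. card (tuples k N)) * (\<Prod>a\<in>{..<m} - S. b)"
      by simp
  qed
  also have "\<dots> = (card (tuples k N) + b) ^ m"
    by (subst prod_add[symmetric]) auto
  finally have *: "card E \<le> (card (tuples k N) + b) ^ m" .
  \<comment> \<open>\<open>b\<close> is a truncated difference. A graph in \<open>E\<close> supplies
    a set inside \<open>N\<close> of size \<open>w\<close>, and for it \<open>Q\<close> shows that
    \<open>D\<close> is at least \<open>card (tuples k N)\<close>, so the difference is
    exact.\<close>
  show ?thesis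
  proof (cases "E = {}")
    case True
    then show ?thesis unfolding E_def by (simp only: card.empty)
  next
    case False
    then obtain G where "wet m k s U G \<subseteq> N" "card (wet m k s U G) = w"
      by (auto simp: E_def)
    then have "card (tuples k N) + b = D" using Q[of "wet m k s U G"] by (simp add: b_def)
    then show ?thesis using * by (simp add: E_def D_def)
  qed
qed

lemma card_between:
  assumes "finite X" "A \<subseteq> X" "card A \<le> p"
  shows "card {N. A \<subseteq> N \<and> N \<subseteq> X \<and> card N = p} = (card X - card A) choose (p - card A)"
proof -
  have fA: "finite A" using assms finite_subset by blast
  have "{N. A \<subseteq> N \<and> N \<subseteq> X \<and> card N = p} = (\<lambda>B. A \<union> B) ` {B. B \<subseteq> X - A \<and> card B = p - card A}"
  proof (intro equalityI subsetI)
    fix N assume N: "N \<in> {N. A \<subseteq> N \<and> N \<subseteq> X \<and> card N = p}"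
    then have "card (N - A) = p - card A" using fA by (simp add: card_Diff_subset)
    moreover have "N = A \<union> (N - A)" using N by auto
    ultimately show "N \<in> (\<lambda>B. A \<union> B) ` {B. B \<subseteq> X - A \<and> card B = p - card A}"
      using N by blast
  next
    fix N assume "N \<in> (\<lambda>B. A \<union> B) ` {B. B \<subseteq> X - A \<and> card B = p - card A}"
    then obtain B where B: "B \<subseteq> X - A" "card B = p - card A" "N = A \<union> B" by auto
    have "finite B" using B(1) assms(1) by (meson finite_Diff finite_subset)
    moreover have "A \<inter> B = {}" using B(1) by auto
    ultimately have "card N = card A + card B" using B(3) fA by (simp add: card_Un_disjoint)
    then show "N \<in> {N. A \<subseteq> N \<and> N \<subseteq> X \<and> card N = p}" using B assms by auto
  qed
  moreover have "inj_on (\<lambda>B. A \<union> B) {B. B \<subseteq> X - A \<and> card B = p - card A}"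
    by (rule inj_onI) auto
  ultimately have "card {N. A \<subseteq> N \<and> N \<subseteq> X \<and> card N = p} = card {B. B \<subseteq> X - A \<and> card B = p - card A}"
    by (simp add: card_image)
  then show ?thesis using assms fA by (simp add: n_subsets card_Diff_subset)
qed

lemma finite_graphs: "finite (graphs n m k)"
  unfolding graphs_eq_PiE_dflt using finite_tuples by (intro finite_PiE_dflt) auto

lemma card_graphs: "card (graphs n m k) = ffact n k ^ m"
  unfolding graphs_eq_PiE_dflt using finite_tuples by (subst card_PiE_dflt) (auto simp: card_tuples)

text \<open>Double counting of pairs of a graph with closure size \<open>w\<close> and a
  \<open>p\<close>-set \<open>N\<close> containing the closure: every such graph has equally many
  \<open>N\<close>, and for each fixed \<open>N\<close> the graphs are bounded by
  \<open>card_wet_subset_le\<close>.\<close>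

lemma card_wet_le:
  assumes U: "U \<subseteq> {1..n}" and w: "w \<le> p" "card U \<le> p"
  shows "((n - w) choose (p - w)) * card {G \<in> graphs n m k. card (wet m k s U G) = w} \<le>
    ((n - card U) choose (p - card U)) *
    (ffact n k - (k choose s) * ffact w s * (ffact (n - w) (k - s) - ffact (p - w) (k - s))) ^ m"
proof -
  define E where "E = {G \<in> graphs n m k. card (wet m k s U G) = w}"
  define NN where "NN = {N. U \<subseteq> N \<and> N \<subseteq> {1..n} \<and> card N = p}"
  have finE: "finite E" using finite_graphs by (simp add: E_def)
  have finN: "finite NN" by (rule finite_subset[of _ "Pow {1..n}"]) (auto simp: NN_def)
  have "((n - w) choose (p - w)) * card E = (\<Sum>G\<in>E. card {N\<in>NN. wet m k s U G \<subseteq> N})"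
  proof -
    have "card {N\<in>NN. wet m k s U G \<subseteq> N} = (n - w) choose (p - w)" if "G \<in> E" for G
    proof -
      have "{N\<in>NN. wet m k s U G \<subseteq> N} = {N. wet m k s U G \<subseteq> N \<and> N \<subseteq> {1..n} \<and> card N = p}"
        using wet_superset[of U m k s G] by (auto simp: NN_def)
      then show ?thesis
        using card_between[of "{1..n}" "wet m k s U G" p] that w wet_subset[OF _ U] by (auto simp: E_def)
    qed
    then show ?thesis by simp
  qed
  also have "\<dots> = (\<Sum>N\<in>NN. card {G\<in>E. wet m k s U G \<subseteq> N})"
    using sum.swap_restrict[OF finE finN, of "\<lambda>_ _. 1 :: nat" "\<lambda>G N. wet m k s U G \<subseteq> N"] by simp
  also have "\<dots> \<le> (\<Sum>N\<in>NN. (ffact n k - (k choose s) * ffact w s * (ffact (n - w) (k - s) - ffact (p - w) (k - s))) ^ m)"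
  proof (rule sum_mono)
    fix N assume N: "N \<in> NN"
    have "{G\<in>E. wet m k s U G \<subseteq> N} = {G \<in> graphs n m k. wet m k s U G \<subseteq> N \<and> card (wet m k s U G) = w}"
      by (auto simp: E_def)
    then show "card {G\<in>E. wet m k s U G \<subseteq> N} \<le> (ffact n k - (k choose s) * ffact w s * (ffact (n - w) (k - s) - ffact (p - w) (k - s))) ^ m"
      using card_wet_subset_le[of N n m k s U w] N by (simp add: NN_def)
  qed
  also have "\<dots> = card NN * (ffact n k - (k choose s) * ffact w s * (ffact (n - w) (k - s) - ffact (p - w) (k - s))) ^ m"
    by simp
  also have "card NN = (n - card U) choose (p - card U)"
    unfolding NN_def using card_between[of "{1..n}" U p] U w by simp
  finally show ?thesis by (simp add: E_def)
qed

section \<open>The probability of a closure of given size\<close>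

lemma ffact_mono: "M \<le> N \<Longrightarrow> ffact M j \<le> ffact N j"
  unfolding ffact_def by (intro prod_mono) auto

lemma ffact_le_power: "ffact N j \<le> N ^ j"
proof -
  have "ffact N j \<le> (\<Prod>i<j. N)" unfolding ffact_def by (intro prod_mono) auto
  then show ?thesis by simp
qed

lemma ffact_pos: "j \<le> N \<Longrightarrow> 0 < ffact N j"
  unfolding ffact_def by (intro prod_pos) auto

lemma power_le_ffact: "(N - j) ^ j \<le> ffact N j"
proof -
  have "(\<Prod>i<j. N - j) \<le> ffact N j" unfolding ffact_def by (intro prod_mono) auto
  then show ?thesis by simp
qed

text \<open>Each step multiplies by \<open>(N + t + 1) / (P + t + 1)\<close>, at most
  \<open>N / P\<close> because \<open>P \<le> N\<close>. This controls the quotient of the two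
  binomials in \<open>card_wet_le\<close>.\<close>

lemma binomial_shift_le:
  assumes "P \<le> N" "0 < P"
  shows "real ((N + t) choose (P + t)) \<le> (real N / real P) ^ t * real (N choose P)"
proof (induction t)
  case (Suc t)
  have "real (Suc (P + t)) * real (Suc (N + t) choose Suc (P + t)) = real (Suc (N + t)) * real ((N + t) choose (P + t))"
    using Suc_times_binomial[of "P + t" "N + t"] by (metis of_nat_mult)
  then have "real (Suc (N + t) choose Suc (P + t)) = real (Suc (N + t)) / real (Suc (P + t)) * real ((N + t) choose (P + t))"
    by (simp add: field_simps)
  also have "\<dots> \<le> (real N / real P) * ((real N / real P) ^ t * real (N choose P))"
  proof (rule mult_mono[OF _ Suc])
    have "real P * real (Suc t) \<le> real N * real (Suc t)" using assms by (intro mult_right_mono) auto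
    then show "real (Suc (N + t)) / real (Suc (P + t)) \<le> real N / real P"
      using assms by (simp add: field_simps)
  qed auto
  finally show ?case by simp
qed simp

text \<open>Divide \<open>card_wet_le\<close> by the number of graphs. The exponential comes from
  \<open>1 - x \<le> exp (- x)\<close> for each constraint, after enlarging \<open>ffact n k\<close>
  to \<open>n ^ k\<close>.\<close>

lemma prob_card_wet_le:
  assumes U: "U \<subseteq> {1..n}" "card U = u" and w: "u \<le> w" "w < p" "p \<le> n" and k: "k \<le> n"
  shows "measure_pmf.prob (random_graph n m k) {G. card (wet m k s U G) = w} \<le>
    (real (n - w) / real (p - w)) ^ (w - u) *
    exp (- (real m * (real (k choose s) * real (ffact w s) *
       (real (ffact (n - w) (k - s)) - real (ffact (p - w) (k - s)))) / real n ^ k))"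
proof -
  define T where "T = ffact n k"
  define b where "b = (k choose s) * ffact w s * (ffact (n - w) (k - s) - ffact (p - w) (k - s))"
  define R where "R = (real (n - w) / real (p - w)) ^ (w - u)"
  let ?E = "{G \<in> graphs n m k. card (wet m k s U G) = w}"
  have T: "0 < T" using ffact_pos[OF k] by (simp add: T_def)
  have b: "real b = real (k choose s) * real (ffact w s) *
       (real (ffact (n - w) (k - s)) - real (ffact (p - w) (k - s)))"
    unfolding b_def using ffact_mono[of "p - w" "n - w" "k - s"] w by simp
  have b0: "0 \<le> real b" by simp
  have cg: "card (graphs n m k) = T ^ m" by (simp add: T_def card_graphs)
  then have "card (graphs n m k) \<noteq> 0" using T by simp
  then have ne: "graphs n m k \<noteq> {}" by force
  have "real ((n - w) choose (p - w)) * real (card ?E) \<le> real ((n - u) choose (p - u)) * real (T - b) ^ m"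
  proof -
    have "((n - w) choose (p - w)) * card ?E \<le> ((n - u) choose (p - u)) * (T - b) ^ m"
      using card_wet_le[OF U(1), of w p m k s] w U(2) unfolding T_def b_def by simp
    then show ?thesis by (simp flip: of_nat_mult of_nat_power)
  qed
  also have "real ((n - u) choose (p - u)) \<le> R * real ((n - w) choose (p - w))"
    using binomial_shift_le[of "p - w" "n - w" "w - u"] w by (simp add: R_def)
  finally have "real ((n - w) choose (p - w)) * real (card ?E) \<le>
      real ((n - w) choose (p - w)) * (R * real (T - b) ^ m)"
    by (simp add: mult_right_mono mult_ac)
  moreover have "0 < real ((n - w) choose (p - w))" using w by simp
  ultimately have E: "real (card ?E) \<le> R * real (T - b) ^ m"
    by (simp only: mult_le_cancel_left_pos)
  have "measure_pmf.prob (random_graph n m k) {G. card (wet m k s U G) = w} = real (card ?E) / real T ^ m"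
  proof -
    have "graphs n m k \<inter> {G. card (wet m k s U G) = w} = ?E" by auto
    then show ?thesis
      unfolding random_graph_def using ne finite_graphs by (simp add: measure_pmf_of_set cg)
  qed
  also have "\<dots> \<le> R * real (T - b) ^ m / real T ^ m"
    using E by (intro divide_right_mono) auto
  also have "\<dots> = R * (real (T - b) / real T) ^ m" by (simp add: power_divide)
  also have "\<dots> \<le> R * exp (- (real b / real n ^ k)) ^ m"
  proof (intro mult_left_mono power_mono)
    have "real T \<le> real n ^ k" using ffact_le_power[of n k] by (simp add: T_def flip: of_nat_power)
    then have "real b / real n ^ k \<le> real b / real T"
      using T by (intro frac_le) auto
    moreover have "1 - real b / real T \<le> exp (- (real b / real T))"
      using exp_ge_add_one_self[of "- (real b / real T)"] by simp
    \<comment> \<open>The maximum covers \<open>T < b\<close>, where the natural difference is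
      0.\<close>
    moreover have "real (T - b) / real T \<le> max 0 (1 - real b / real T)"
      using T by (cases "b \<le> T") (simp_all add: of_nat_diff diff_divide_distrib)
    ultimately show "real (T - b) / real T \<le> exp (- (real b / real n ^ k))"
      by (smt (verit) exp_gt_zero exp_le_cancel_iff)
  qed (auto simp: R_def)
  also have "exp (- (real b / real n ^ k)) ^ m = exp (- (real m * real b / real n ^ k))"
    by (simp flip: exp_of_nat_mult)
  finally show ?thesis unfolding R_def b .
qed

section \<open>From stopping sets to closures\<close>

text \<open>An edge with at least \<open>r - 1\<close> of its \<open>k\<close> points outside
  \<open>V\<close> has at most \<open>k - r + 1\<close> in \<open>V\<close>, and the stopping
  condition forbids every positive value up to that bound.\<close>

lemma wet_disjoint_stopping_set:
  assumes G: "G \<in> graphs n m k" and r: "1 \<le> r" "r \<le> k" and V: "V \<subseteq> {u + 1..n}"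
    and st: "stopping_set m k G (k - r + 2) V" and u: "u \<le> n"
  shows "wet m k (r - 1) {1..u} G \<subseteq> {1..n} - V"
  unfolding wet_def
proof (rule least_closed_least)
  show "{1..u} \<subseteq> {1..n} - V" using V u by auto
  fix e assume "e \<in> nbhd k G ` {..<m}" and c: "r - 1 \<le> card (e \<inter> ({1..n} - V))"
  then obtain a where a: "a < m" "e = nbhd k G a" by auto
  have e: "e \<subseteq> {1..n}" using nbhd_subset[OF G a(1)] a(2) by simp
  have ck: "card e = k"
    using G a by (simp add: graphs_def nbhd_def card_image)
  have fin: "finite e" using a(2) by simp
  have "card e = card (e \<inter> ({1..n} - V)) + card (e \<inter> V)"
    using e fin by (subst card_Un_disjoint[symmetric]) (auto intro!: arg_cong[of _ _ card])
  then have "card (e \<inter> V) \<le> k - r + 1" using c ck r by linarith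
  moreover have "card (e \<inter> V) \<notin> {1..k - r + 2 - 1}"
    using st a by (auto simp: stopping_set_def)
  ultimately have "card (e \<inter> V) = 0" by auto
  then have "e \<inter> V = {}" using fin by simp
  then show "e \<subseteq> {1..n} - V" using e by auto
qed

text \<open>Union bound over the closure size: the closure contains \<open>{1..u}\<close> and misses
  any large stopping set in \<open>{u + 1..n}\<close>.\<close>

lemma prob_no_large_stopping_set_ge:
  assumes r: "1 \<le> r" "r \<le> k" and n: "u \<le> n" "k \<le> n"
  shows "measure_pmf.prob (random_graph n m k)
      {G. \<not> (\<exists>V. V \<subseteq> {u + 1..n} \<and> large_stopping_set n m k G \<alpha> (k - r + 2) V)}
    \<ge> 1 - (\<Sum>w\<in>{w. u \<le> w \<and> real w \<le> (1 - \<alpha>) * real n}.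
          measure_pmf.prob (random_graph n m k) {G. card (wet m k (r - 1) {1..u} G) = w})"
    (is "measure_pmf.prob ?M ?A \<ge> 1 - (\<Sum>w\<in>?I. measure_pmf.prob ?M (?E w))")
proof -
  have "card (graphs n m k) \<noteq> 0" using ffact_pos[OF n(2)] by (simp add: card_graphs)
  then have ne: "graphs n m k \<noteq> {}" by force
  let ?L = "nat \<lfloor>(1 - \<alpha>) * real n\<rfloor>"
  have finI: "finite ?I"
    by (rule finite_subset[of _ "{..?L}"]) (auto simp: le_nat_floor)
  have supp: "set_pmf ?M = graphs n m k"
    unfolding random_graph_def using ne finite_graphs by (rule set_pmf_of_set)
  have "1 - measure_pmf.prob ?M ?A = measure_pmf.prob ?M (UNIV - ?A)"
    using measure_pmf.prob_compl[of ?A ?M] by simp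
  also have "\<dots> \<le> measure_pmf.prob ?M (\<Union>w\<in>?I. ?E w)"
  proof (rule measure_pmf.finite_measure_mono_AE)
    show "AE G in ?M. G \<in> UNIV - ?A \<longrightarrow> G \<in> (\<Union>w\<in>?I. ?E w)"
    proof (rule AE_pmfI, rule impI)
      fix G assume G: "G \<in> set_pmf ?M" "G \<in> UNIV - ?A"
      then obtain V where V: "V \<subseteq> {u + 1..n}" "large_stopping_set n m k G \<alpha> (k - r + 2) V" by auto
      let ?W = "wet m k (r - 1) {1..u} G"
      have sub: "?W \<subseteq> {1..n} - V"
        using wet_disjoint_stopping_set[OF _ r V(1) _ n(1)] V(2) G(1) supp
        by (auto simp: large_stopping_set_def)
      have V1: "V \<subseteq> {1..n}" using V(1) by auto
      have "card ?W \<le> card ({1..n} - V)" using sub by (intro card_mono) auto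
      also have "\<dots> = n - card V" using V1 by (subst card_Diff_subset) (auto intro: finite_subset)
      finally have "real (card ?W) \<le> real n - real (card V)"
        using card_mono[OF _ V1] by simp
      then have "real (card ?W) \<le> (1 - \<alpha>) * real n"
        using V(2) by (simp add: large_stopping_set_def algebra_simps)
      moreover have "card {1..u} \<le> card ?W"
        using sub wet_superset finite_subset by (intro card_mono) (blast, auto)
      ultimately show "G \<in> (\<Union>w\<in>?I. ?E w)" by auto
    qed
  qed auto
  also have "\<dots> \<le> (\<Sum>w\<in>?I. measure_pmf.prob ?M (?E w))"
    using finI by (intro measure_pmf.finite_measure_subadditive_finite) auto
  finally show ?thesis by simp
qed

section \<open>Small closures\<close>

text \<open>For \<open>j \<le> N\<close> apply Bernoulli's inequality to \<open>(N - j) ^ j\<close>;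
  for \<open>j > N\<close> the left side is at most 0.\<close>

lemma ffact_ratio_ge:
  assumes "N \<le> M" "0 < M"
  shows "1 - real j * (real M - real N + real j) / real M \<le> real (ffact N j) / real M ^ j"
proof (cases "j \<le> N")
  case True
  define y where "y = (real M - real N + real j) / real M"
  have y: "1 - y = real (N - j) / real M"
    using assms True by (simp add: y_def field_simps of_nat_diff)
  have "0 \<le> real (N - j) / real M" by simp
  with y have "- 1 \<le> - y" by linarith
  then have "1 + real j * (- y) \<le> (1 + - y) ^ j" by (rule Bernoulli_inequality)
  also have "(1 + - y) ^ j = real ((N - j) ^ j) / real M ^ j"
    using y by (simp add: power_divide)
  also have "\<dots> \<le> real (ffact N j) / real M ^ j"
    using power_le_ffact[of N j] by (intro divide_right_mono) (simp_all only: of_nat_le_iff, simp)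
  finally show ?thesis by (simp add: y_def)
next
  case False
  have "1 * real M \<le> real j * (real M - real N + real j)"
    using False assms by (intro mult_mono) auto
  then have "1 - real j * (real M - real N + real j) / real M \<le> 0"
    using assms by (simp add: field_simps)
  also have "0 \<le> real (ffact N j) / real M ^ j" by simp
  finally show ?thesis .
qed

text \<open>Split off the top factor of each and enlarge the remaining factors for \<open>M\<close>
  to those for \<open>N\<close>.\<close>

lemma ffact_diff_ge:
  assumes "M \<le> N"
  shows "real (N - M) * real (ffact (N - 1) j) \<le> real (ffact N (Suc j)) - real (ffact M (Suc j))"
proof -
  have shift: "ffact N (Suc j) = N * ffact (N - 1) j" for N
    unfolding ffact_def by (subst prod.lessThan_Suc_shift) simp
  have "M * ffact (M - 1) j \<le> M * ffact (N - 1) j"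
    using assms by (intro mult_left_mono ffact_mono) auto
  then have "real M * real (ffact (M - 1) j) \<le> real M * real (ffact (N - 1) j)"
    by (metis of_nat_le_iff of_nat_mult)
  then show ?thesis using assms by (simp add: shift of_nat_diff algebra_simps)
qed

text \<open>The error \<open>s ^ 2 / w\<close> comes from \<open>ffact w s\<close>, the error
  \<open>h * (w + h) / n\<close> from \<open>ffact (n - w) h\<close>, and the final
  \<open>- c\<close> from rounding \<open>m\<close>.\<close>

lemma exponent_ge:
  fixes \<mu> :: real
  assumes s: "0 < s" and u: "0 < u" "u \<le> w" and w: "w \<le> p" "p \<le> n" and \<mu>: "0 \<le> \<mu>"
    and m: "\<mu> * real n ^ s / real u ^ (s - 1) - 1 \<le> real m"
  shows "\<mu> * real c * real u * (real w / real u) ^ s *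
      (1 - (real p / real n) ^ h - real h * (real w + real h) / real n - real s ^ 2 / real w) - real c
    \<le> real m * (real c * real (ffact w s) * (real (ffact (n - w) h) - real (ffact (p - w) h))) / real n ^ (s + h)"
proof -
  have pos: "0 < w" "0 < n" using u w by auto
  define a where "a = real (ffact w s) / real n ^ s"
  define A where "A = (real w / real n) ^ s"
  define b where "b = (real (ffact (n - w) h) - real (ffact (p - w) h)) / real n ^ h"
  have "1 - real s ^ 2 / real w \<le> real (ffact w s) / real w ^ s"
    using ffact_ratio_ge[of w w s] pos by (simp add: power2_eq_square)
  then have "A * (1 - real s ^ 2 / real w) \<le> A * (real (ffact w s) / real w ^ s)"
    by (intro mult_left_mono) (auto simp: A_def)
  also have "\<dots> = a" using pos by (simp add: A_def a_def power_divide)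
  finally have a: "A * (1 - real s ^ 2 / real w) \<le> a" .
  have b0: "0 \<le> b"
    unfolding b_def using ffact_mono[of "p - w" "n - w" h] w by simp
  have "real (ffact (n - w) h) \<le> real n ^ h"
    using ffact_le_power[of "n - w" h] power_mono[of "n - w" n h]
    by (metis diff_le_self le_trans of_nat_le_iff of_nat_power zero_le)
  then have "real (ffact (n - w) h) - real (ffact (p - w) h) \<le> real n ^ h"
    by (meson diff_le_eq le_add_same_cancel1 of_nat_0_le_iff order_trans)
  then have b1: "b \<le> 1" unfolding b_def using pos by (simp only: divide_le_eq) simp
  have "real (ffact w s) \<le> real n ^ s"
    using ffact_le_power[of w s] power_mono[of w n s] w
    by (metis le_trans of_nat_le_iff of_nat_power zero_le)
  then have a1: "a \<le> 1" unfolding a_def using pos by (simp add: divide_le_eq)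
  have a0: "0 \<le> a" by (simp add: a_def)
  have "1 - real h * (real w + real h) / real n \<le> real (ffact (n - w) h) / real n ^ h"
    using ffact_ratio_ge[of "n - w" n h] pos w by (simp add: of_nat_diff)
  moreover have "real (ffact (p - w) h) \<le> real p ^ h"
    using ffact_le_power[of "p - w" h] power_mono[of "p - w" p h]
    by (metis diff_le_self le_trans of_nat_le_iff of_nat_power zero_le)
  then have "real (ffact (p - w) h) / real n ^ h \<le> (real p / real n) ^ h"
    using pos by (simp add: power_divide divide_right_mono)
  ultimately have b: "1 - (real p / real n) ^ h - real h * (real w + real h) / real n \<le> b"
    by (simp add: b_def diff_divide_distrib)
  define M where "M = \<mu> * real n ^ s / real u ^ (s - 1)"
  have M0: "0 \<le> M" using \<mu> by (simp add: M_def)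
  have A0: "0 \<le> A" by (simp add: A_def)
  \<comment> \<open>The powers of \<open>n\<close> cancel: this scaling of \<open>m\<close> makes
    the exponent of order \<open>u\<close>.\<close>
  have MA: "M * A = \<mu> * real u * (real w / real u) ^ s"
  proof -
    obtain j where "s = Suc j" using s gr0_implies_Suc by blast
    then show ?thesis using pos u by (simp add: M_def A_def power_divide field_simps)
  qed
  have "A * (1 - (real p / real n) ^ h - real h * (real w + real h) / real n - real s ^ 2 / real w)
      \<le> A * (b - b * (real s ^ 2 / real w))"
  proof (intro mult_left_mono A0 diff_mono b)
    show "b * (real s ^ 2 / real w) \<le> real s ^ 2 / real w"
      using b1 by (intro mult_left_le_one_le b0) auto
  qed
  also have "\<dots> = (A * (1 - real s ^ 2 / real w)) * b" by (simp add: algebra_simps)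
  also have "\<dots> \<le> a * b" using a b0 by (rule mult_right_mono)
  finally have "M * (A * (1 - (real p / real n) ^ h - real h * (real w + real h) / real n - real s ^ 2 / real w)) \<le> M * (a * b)"
    using M0 by (rule mult_left_mono)
  \<comment> \<open>\<open>m\<close> may fall short of \<open>M\<close> by 1, which costs at most
    \<open>a * b \<le> 1\<close>.\<close>
  also have "\<dots> \<le> real m * (a * b) + a * b"
  proof -
    have "M * (a * b) \<le> (real m + 1) * (a * b)"
      using m a0 b0 by (intro mult_right_mono) (auto simp: M_def)
    then show ?thesis by (simp add: algebra_simps)
  qed
  also have "\<dots> \<le> real m * (a * b) + 1"
    using mult_le_one[OF a1 b0 b1] by simp
  finally have "real c * ((M * A) * (1 - (real p / real n) ^ h - real h * (real w + real h) / real n - real s ^ 2 / real w))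
     \<le> real c * (real m * (a * b) + 1)"
    by (intro mult_left_mono) (auto simp: mult_ac)
  moreover have "real c * (real m * (a * b)) =
      real m * (real c * real (ffact w s) * (real (ffact (n - w) h) - real (ffact (p - w) h))) / real n ^ (s + h)"
    by (simp add: a_def b_def power_add)
  ultimately show ?thesis unfolding MA by (simp add: algebra_simps)
qed

text \<open>\<open>z = exp \<lambda>\<close> is the fraction of the vertices kept in \<open>N\<close>. The error terms are \<open>O(u\<^sup>2/n)\<close> only if this
  fraction is at least \<open>c \<tau>\<close> and \<open>b = 2w/n\<close>; raising it to these values costs little, since below
  \<open>c \<tau>\<close> the rate decreases in \<open>z\<close>.\<close>
lemma rate_truncate_le:
  fixes z b c D \<tau> :: real
  assumes z: "0 < z" "z < 1" and b: "0 \<le> b" "b \<le> 1" and \<tau>: "0 \<le> \<tau>" and c: "0 \<le> c" "c * \<tau> \<le> 1"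
    and D: "0 \<le> D" "D * real h * c \<le> 1" and h: "0 < h"
    and X: "X = max z (max (c * \<tau>) b)"
  shows "D * (X ^ h - 1) - \<tau> * ln X \<le> D * (z ^ h - 1) - \<tau> * ln z + D * b"
proof -
  have zX: "z \<le> X" and X1: "X \<le> 1" and X0: "0 < X" using assms by auto
  then have ln: "\<tau> * ln z \<le> \<tau> * ln X" using z \<tau> by (intro mult_left_mono) auto
  have Xh: "X ^ h \<le> X" using power_decreasing[of 1 h X] h X0 X1 by simp
  have Db: "0 \<le> D * b" "0 \<le> D * z ^ h" using D b z by auto
  consider "X = z" | "X = b" | "X = c * \<tau>" using X by linarith
  then show ?thesis
  proof cases
    case 1
    then show ?thesis using Db by simp
  next
    case 2
    then have "D * X ^ h \<le> D * b" using Xh D by (intro mult_left_mono) auto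
    then show ?thesis using ln Db by (simp add: algebra_simps)
  next
    case 3
    \<comment> \<open>\<open>1 - exp (- y) \<le> y\<close> with \<open>y = h * (ln X - ln z)\<close>
      bounds the rise of \<open>X ^ h\<close>; the condition on \<open>c\<close> makes it at most
      the gain in \<open>- \<tau> * ln X\<close>.\<close>
    have "1 + real h * ln (z / X) \<le> exp (real h * ln (z / X))" by (rule exp_ge_add_one_self)
    also have "\<dots> = (z / X) ^ h" using z X0 by (simp add: exp_of_nat_mult)
    finally have "X ^ h * (1 - (z / X) ^ h) \<le> X ^ h * (real h * (ln X - ln z))"
      using z X0 by (intro mult_left_mono) (auto simp: ln_div algebra_simps)
    also have "X ^ h * (1 - (z / X) ^ h) = X ^ h - z ^ h"
      using X0 by (simp add: power_divide algebra_simps)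
    finally have "D * (X ^ h - z ^ h) \<le> D * (X ^ h * (real h * (ln X - ln z)))"
      using D by (intro mult_left_mono) auto
    also have "\<dots> = (D * real h * X ^ h) * (ln X - ln z)" by (simp add: mult_ac)
    also have "\<dots> \<le> \<tau> * (ln X - ln z)"
    proof (rule mult_right_mono)
      have "D * real h * X ^ h \<le> D * real h * X" using D Xh by (intro mult_left_mono) auto
      also have "\<dots> = (D * real h * c) * \<tau>" using 3 by simp
      also have "\<dots> \<le> \<tau>" using D \<tau> c by (intro mult_left_le_one_le) auto
      finally show "D * real h * X ^ h \<le> \<tau>" .
      show "0 \<le> ln X - ln z" using zX z by simp
    qed
    finally show ?thesis using Db by (simp add: algebra_simps)
  qed
qed

lemma power_diff_le:
  fixes x y :: real
  assumes "0 \<le> y" "y \<le> x" "x \<le> 1"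
  shows "x ^ h - y ^ h \<le> real h * (x - y)"
proof (induction h)
  case (Suc h)
  have "x ^ Suc h - y ^ Suc h = x * (x ^ h - y ^ h) + y ^ h * (x - y)" by (simp add: algebra_simps)
  also have "\<dots> \<le> 1 * (x ^ h - y ^ h) + 1 * (x - y)"
    using assms by (intro add_mono mult_right_mono) (auto simp: power_mono power_le_one)
  also have "\<dots> \<le> real (Suc h) * (x - y)" using Suc by (simp add: algebra_simps)
  finally show ?case .
qed simp

text \<open>With \<open>y = w / p \<le> 1 / 2\<close> the base is at most
  \<open>(n / p) / (1 - y)\<close>, and
  \<open>1 / (1 - y) \<le> 1 + 2 * y \<le> exp (2 * y)\<close>.\<close>

lemma power_ratio_le_exp:
  assumes w: "2 * w \<le> p" "p \<le> n" "0 < p" and X: "0 < X" "X * real n \<le> real p" "X \<le> 1"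
  shows "(real (n - w) / real (p - w)) ^ t \<le> exp (- (real t * ln X) + 2 * (real t * real w / real p))"
proof -
  define y where "y = real w / real p"
  have y: "0 \<le> y" "y \<le> 1 / 2" using w by (auto simp: y_def field_simps)
  have pw: "real (p - w) = real p * (1 - y)"
    using w by (simp add: y_def of_nat_diff field_simps)
  have "real (n - w) / real (p - w) \<le> real n / (real p * (1 - y))"
    unfolding pw using y w by (intro divide_right_mono) auto
  also have "\<dots> = (real n / real p) * (1 / (1 - y))" by simp
  also have "\<dots> \<le> (1 / X) * exp (2 * y)"
  proof (intro mult_mono)
    show "real n / real p \<le> 1 / X" using X w by (simp add: field_simps)
    have "1 \<le> (1 + 2 * y) * (1 - y)" using mult_left_mono[of y "1/2" y] y by (simp add: algebra_simps)
    then have "1 / (1 - y) \<le> 1 + 2 * y" using y by (simp add: field_simps)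
    also have "\<dots> \<le> exp (2 * y)" by (rule exp_ge_add_one_self)
    finally show "1 / (1 - y) \<le> exp (2 * y)" .
  qed (use X y in auto)
  also have "\<dots> = exp (- ln X + 2 * y)" using X by (simp only: exp_add exp_minus exp_ln) (simp add: field_simps)
  finally have "(real (n - w) / real (p - w)) ^ t \<le> exp (- ln X + 2 * y) ^ t"
    by (intro power_mono) auto
  also have "\<dots> = exp (real t * (- ln X + 2 * y))" by (rule exp_of_nat_mult[symmetric])
  finally show ?thesis by (simp add: y_def algebra_simps)
qed

text \<open>Closures of size at most \<open>(1 + K) * u\<close>. The constant \<open>B\<close> is
  chosen before \<open>lam\<close>, since the infimum over \<open>lam\<close> is taken later for
  each \<open>\<tau>\<close>.\<close>

lemma prob_card_wet_near_le:
  fixes \<mu> K :: real and s h :: nat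
  assumes s: "0 < s" and h: "0 < h" and \<mu>: "0 < \<mu>" and K: "0 \<le> K"
  defines "rate \<equiv> \<lambda>lam \<tau>. \<mu> * real ((s + h) choose s) * (1 + \<tau>) ^ s * (exp (real h * lam) - 1) - lam * \<tau>"
  shows "\<exists>B\<ge>0. \<forall>n u t m lam. 0 < u \<longrightarrow> 2 * (1 + K) * real u \<le> real n \<longrightarrow> s + h \<le> n \<longrightarrow> real t \<le> K * real u \<longrightarrow>
     \<mu> * real n ^ s / real u ^ (s - 1) - 1 \<le> real m \<longrightarrow> lam < 0 \<longrightarrow>
     measure_pmf.prob (random_graph n m (s + h)) {G. card (wet m (s + h) s {1..u} G) = u + t} \<le>
     exp (real u * rate lam (real t / real u) + B * (real u ^ 2 / real n + 1))"
proof -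
  define N where "N = real ((s + h) choose s)"
  \<comment> \<open>\<open>E\<close> bounds the coefficient \<open>D\<close> for all
    \<open>\<tau> \<le> K\<close>. The denominator of \<open>c\<close> gives both
    \<open>c * K \<le> 1\<close> and \<open>E * h * c \<le> 1\<close>, as
    \<open>rate_truncate_le\<close> demands. \<open>B1\<close> collects the coefficients of
    \<open>u ^ 2 / n\<close>, \<open>B2\<close> the bounded errors.\<close>
  define E where "E = \<mu> * N * (1 + K) ^ s"
  define c where "c = 1 / (1 + K + E * real h)"
  define B1 where "B1 = 2 * (1 + K) / c + E * real h * (1 + K) + 2 * E * (1 + K)"
  define B2 where "B2 = E * real h + E * real h ^ 2 + E * real s ^ 2 + N"
  have N0: "0 \<le> N" by (simp add: N_def)
  have E0: "0 \<le> E" using \<mu> K N0 by (simp add: E_def)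
  have Eh: "0 \<le> E * real h" using E0 by simp
  then have den: "1 \<le> 1 + K + E * real h" using K by linarith
  have c0: "0 < c" using den by (simp add: c_def)
  have cK: "c * K \<le> 1" and cE: "E * real h * c \<le> 1"
    using den K Eh by (simp_all add: c_def divide_le_eq)
  have B: "0 \<le> B1" "0 \<le> B2" using K E0 c0 N0 by (auto simp: B1_def B2_def)
  show ?thesis
  proof (intro exI[of _ "B1 + B2"] conjI allI impI)
    show "0 \<le> B1 + B2" using B by simp
    fix n u t m :: nat and lam :: real
    assume u: "0 < u" and un: "2 * (1 + K) * real u \<le> real n" and kn: "s + h \<le> n"
      and t: "real t \<le> K * real u"
      and m: "\<mu> * real n ^ s / real u ^ (s - 1) - 1 \<le> real m" and lam: "lam < 0"
    define w where "w = u + t"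
    define \<tau> where "\<tau> = real t / real u"
    define D where "D = \<mu> * N * (1 + \<tau>) ^ s"
    define z where "z = exp lam"
    \<comment> \<open>As a lower bound for the kept fraction, \<open>b\<close> ensures
      \<open>2 * w \<le> p\<close>.\<close>
    define b where "b = 2 * real w / real n"
    define X where "X = max z (max (c * \<tau>) b)"
    define p where "p = nat \<lceil>X * real n\<rceil>"
    have n0: "0 < real n" using kn s by simp
    have u0: "0 < real u" using u by simp
    have \<tau>: "0 \<le> \<tau>" "\<tau> \<le> K" using t u0 by (auto simp: \<tau>_def field_simps)
    have tu: "real t = \<tau> * real u" using u0 by (simp add: \<tau>_def)
    have wu: "real w = (1 + \<tau>) * real u" by (simp add: w_def tu algebra_simps)
    have wK: "real w \<le> (1 + K) * real u" unfolding wu using \<tau> by (intro mult_right_mono) auto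
    have w0: "1 \<le> real w" using u by (simp add: w_def)
    have b: "0 < b" "b \<le> 1" using wK un w0 n0 by (auto simp: b_def field_simps)
    have z: "0 < z" "z < 1" using lam by (auto simp: z_def)
    have "c * \<tau> \<le> c * K" using \<tau> c0 by (intro mult_left_mono) auto
    then have c\<tau>: "c * \<tau> \<le> 1" using cK by linarith
    have X: "0 < X" "X \<le> 1" "b \<le> X" "c * \<tau> \<le> X" using z b c\<tau> by (auto simp: X_def)
    have D: "0 \<le> D" "D \<le> E"
      using \<mu> N0 \<tau> unfolding D_def E_def by (auto intro!: mult_left_mono power_mono)
    have "D * (real h * c) \<le> E * (real h * c)" using D c0 by (intro mult_right_mono) auto
    then have Dc: "D * real h * c \<le> 1" using cE by (simp add: mult_ac)
    have rp: "real p = of_int \<lceil>X * real n\<rceil>" using X n0 by (simp add: p_def)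
    then have p1: "X * real n \<le> real p" and p2: "real p \<le> X * real n + 1" by linarith+
    have "X * real n \<le> real n" using X n0 by simp
    then have "\<lceil>X * real n\<rceil> \<le> int n" by (simp add: ceiling_le_iff)
    then have pn: "p \<le> n" unfolding p_def by linarith
    have "2 * real w = b * real n" using n0 by (simp add: b_def)
    also have "\<dots> \<le> X * real n" using X n0 by (intro mult_right_mono) auto
    also note p1
    finally have wp: "2 * w \<le> p" by linarith
    have wpos: "0 < w" using u by (simp add: w_def)
    let ?x = "real p / real n"
    have x: "X \<le> ?x" "?x \<le> X + 1 / real n" "?x \<le> 1"
      using p1 p2 pn n0 by (auto simp: field_simps)
    have "?x ^ h - X ^ h \<le> real h * (?x - X)" using x X by (intro power_diff_le) auto
    also have "\<dots> \<le> real h * (1 / real n)" using x by (intro mult_left_mono) auto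
    finally have xh: "?x ^ h \<le> X ^ h + real h / real n" by simp
    have un1: "real u / real n \<le> 1"
    proof -
      have "real u \<le> 2 * (1 + K) * real u" using K u0 by (simp add: algebra_simps)
      then show ?thesis using un n0 by simp
    qed
    have "measure_pmf.prob (random_graph n m (s + h)) {G. card (wet m (s + h) s {1..u} G) = w} \<le>
       (real (n - w) / real (p - w)) ^ (w - u) *
       exp (- (real m * (real ((s + h) choose s) * real (ffact w s) *
       (real (ffact (n - w) (s + h - s)) - real (ffact (p - w) (s + h - s)))) / real n ^ (s + h)))"
    proof (rule prob_card_wet_le)
      have "u \<le> n" using un1 n0 by (simp add: field_simps)
      then show "{1..u} \<subseteq> {1..n}" by auto
    qed (use wp wpos pn kn in \<open>auto simp: w_def\<close>)
    also have "\<dots> \<le> exp (- (real t * ln X) + 2 * (real t * real w / real p)) *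
       exp (- (\<mu> * N * real u * (real w / real u) ^ s *
      (1 - ?x ^ h - real h * (real w + real h) / real n - real s ^ 2 / real w) - N))"
    proof (rule mult_mono)
      show "(real (n - w) / real (p - w)) ^ (w - u) \<le> exp (- (real t * ln X) + 2 * (real t * real w / real p))"
        using power_ratio_le_exp[OF wp pn _ X(1) p1 X(2), of t] wp wpos by (simp add: w_def)
      show "exp (- (real m * (real ((s + h) choose s) * real (ffact w s) *
       (real (ffact (n - w) (s + h - s)) - real (ffact (p - w) (s + h - s)))) / real n ^ (s + h)))
       \<le> exp (- (\<mu> * N * real u * (real w / real u) ^ s *
      (1 - ?x ^ h - real h * (real w + real h) / real n - real s ^ 2 / real w) - N))"
        using exponent_ge[OF s u _ _ pn _ m, of w "(s + h) choose s" h] wp \<mu>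
        by (simp add: w_def N_def)
    qed auto
    also have "\<dots> = exp (- (real t * ln X) + 2 * (real t * real w / real p) -
        real u * D * (1 - ?x ^ h - real h * (real w + real h) / real n - real s ^ 2 / real w) + N)"
    proof -
      have "real w / real u = 1 + \<tau>" using wu u0 by simp
      then show ?thesis by (simp add: D_def mult_ac flip: exp_add)
    qed
    also have "\<dots> \<le> exp (real u * rate lam \<tau> + (B1 + B2) * (real u ^ 2 / real n + 1))"
    proof -
      define q where "q = real u ^ 2 / real n"
      have q0: "0 \<le> q" by (simp add: q_def)
      \<comment> \<open>Here the cut at \<open>c * \<tau>\<close> is needed:
        \<open>p \<ge> c * \<tau> * n\<close> cancels the \<open>\<tau>\<close> in
        \<open>t = \<tau> * u\<close>.\<close>
      have e1: "2 * (real t * real w / real p) \<le> 2 * (1 + K) / c * q"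
      proof (cases "t = 0")
        case True
        then show ?thesis using K c0 q0 by simp
      next
        case False
        then have \<tau>0: "0 < \<tau>" using u0 by (simp add: \<tau>_def)
        have "c * \<tau> * real n \<le> X * real n" using X n0 by (intro mult_right_mono) auto
        then have "c * \<tau> * real n \<le> real p" using p1 by linarith
        then have "real t * real w / real p \<le> real t * real w / (c * \<tau> * real n)"
          using c0 \<tau>0 n0 by (intro frac_le) auto
        also have "\<dots> = real u * real w / (c * real n)"
          using \<tau>0 by (simp add: tu field_simps)
        also have "\<dots> \<le> real u * ((1 + K) * real u) / (c * real n)"
          using wK c0 n0 by (intro divide_right_mono mult_left_mono) auto
        also have "\<dots> = (1 + K) / c * q" by (simp add: q_def power2_eq_square)
        finally have "2 * (real t * real w / real p) \<le> 2 * ((1 + K) / c * q)"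
          by (rule mult_left_mono) simp
        then show ?thesis by (simp only: times_divide_eq_right times_divide_eq_left mult.assoc)
      qed
      have e2: "real u * D * (?x ^ h) \<le> real u * (D * X ^ h) + E * real h"
      proof -
        have "real u * D * ?x ^ h \<le> real u * D * (X ^ h + real h / real n)"
          using xh D by (intro mult_left_mono) auto
        also have "\<dots> = real u * (D * X ^ h) + D * real h * (real u / real n)"
          by (simp add: algebra_simps)
        also have "D * real h * (real u / real n) \<le> E * real h * 1"
          using D un1 by (intro mult_mono) auto
        finally show ?thesis by simp
      qed
      have e3: "real u * D * (real h * (real w + real h) / real n) \<le> E * real h * (1 + K) * q + E * real h ^ 2"
      proof -
        have "real u * D * (real h * (real w + real h) / real n) =
            D * (real h * (real u * real w / real n)) + D * (real h ^ 2 * (real u / real n))"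
          by (simp add: algebra_simps add_divide_distrib power2_eq_square)
        also have "\<dots> \<le> E * (real h * ((1 + K) * q)) + E * (real h ^ 2 * 1)"
        proof (intro add_mono mult_mono[OF D(2)] mult_left_mono)
          have "real u * real w / real n \<le> real u * ((1 + K) * real u) / real n"
            using wK n0 by (intro divide_right_mono mult_left_mono) auto
          then show "real u * real w / real n \<le> (1 + K) * q"
            by (simp add: q_def power2_eq_square mult_ac)
        qed (use E0 un1 in auto)
        finally show ?thesis by (simp add: mult_ac)
      qed
      have e4: "real u * D * (real s ^ 2 / real w) \<le> E * real s ^ 2"
      proof -
        have "real u * D * (real s ^ 2 / real w) = D * (real s ^ 2 * (real u / real w))" by simp
        also have "\<dots> \<le> E * (real s ^ 2 * 1)"
          using wpos E0 by (intro mult_mono[OF D(2)] mult_left_mono) (auto simp: w_def)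
        finally show ?thesis by simp
      qed
      \<comment> \<open>Passing from \<open>X\<close> back to \<open>z\<close> costs
        \<open>u * D * b\<close>, of order \<open>u ^ 2 / n\<close> by the choice of
        \<open>b\<close>.\<close>
      have e5: "real u * (D * (X ^ h - 1) - \<tau> * ln X) \<le> real u * rate lam \<tau> + 2 * E * (1 + K) * q"
      proof -
        have "D * (X ^ h - 1) - \<tau> * ln X \<le> D * (z ^ h - 1) - \<tau> * ln z + D * b"
          using z b \<tau> c0 c\<tau> D Dc h by (intro rate_truncate_le[where c = c]) (auto simp: X_def)
        also have "D * (z ^ h - 1) - \<tau> * ln z = rate lam \<tau>"
          by (simp add: z_def rate_def D_def N_def mult_ac flip: exp_of_nat_mult)
        finally have "real u * (D * (X ^ h - 1) - \<tau> * ln X) \<le> real u * (rate lam \<tau> + D * b)"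
          by (intro mult_left_mono) auto
        moreover have "real u * (D * b) \<le> 2 * E * (1 + K) * q"
        proof -
          have "real u * (D * b) = D * (2 * (real u * real w / real n))" by (simp add: b_def)
          also have "\<dots> \<le> E * (2 * (real u * ((1 + K) * real u) / real n))"
            using wK n0 E0 by (intro mult_mono[OF D(2)] mult_left_mono divide_right_mono) auto
          also have "\<dots> = 2 * E * (1 + K) * q" by (simp add: q_def power2_eq_square)
          finally show ?thesis .
        qed
        ultimately show ?thesis by (simp add: algebra_simps)
      qed
      have "- (real t * ln X) + 2 * (real t * real w / real p) -
          real u * D * (1 - ?x ^ h - real h * (real w + real h) / real n - real s ^ 2 / real w) + N
        = 2 * (real t * real w / real p) + (real u * D * (?x ^ h) - real u * D - real u * \<tau> * ln X)
          + real u * D * (real h * (real w + real h) / real n) + real u * D * (real s ^ 2 / real w) + N"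
        by (simp add: tu algebra_simps)
      also have "\<dots> \<le> 2 * (1 + K) / c * q + (real u * rate lam \<tau> + 2 * E * (1 + K) * q + E * real h)
          + (E * real h * (1 + K) * q + E * real h ^ 2) + E * real s ^ 2 + N"
      proof -
        have "real u * D * (?x ^ h) - real u * D - real u * \<tau> * ln X
          \<le> real u * (D * (X ^ h - 1) - \<tau> * ln X) + E * real h"
          using e2 by (simp add: algebra_simps)
        then show ?thesis using e1 e3 e4 e5 by linarith
      qed
      also have "\<dots> = real u * rate lam \<tau> + B1 * q + B2"
        by (simp add: B1_def B2_def algebra_simps)
      also have "\<dots> \<le> real u * rate lam \<tau> + (B1 + B2) * (q + 1)"
      proof -
        have "0 \<le> B1" "0 \<le> B2 * q" using B q0 by auto
        then show ?thesis by (simp add: algebra_simps)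
      qed
      finally show ?thesis by (simp add: q_def)
    qed
    finally show "measure_pmf.prob (random_graph n m (s + h)) {G. card (wet m (s + h) s {1..u} G) = u + t} \<le>
     exp (real u * rate lam (real t / real u) + (B1 + B2) * (real u ^ 2 / real n + 1))"
      by (simp add: w_def \<tau>_def)
  qed
qed

section \<open>Large closures\<close>

text \<open>With \<open>p\<close> about \<open>(1 - \<alpha> / 2) * n\<close>, averaging costs at
  most a factor \<open>exp w\<close>, while the exponent is at least of order
  \<open>w ^ s / u ^ (s - 1)\<close>. As \<open>s \<ge> 2\<close>, this beats any linear rate once
  \<open>w > K * u\<close> for large \<open>K\<close>.\<close>

lemma prob_card_wet_far_le:
  fixes \<mu> \<alpha> L :: real and s h :: nat
  assumes s: "2 \<le> s" and h: "0 < h" and \<mu>: "0 < \<mu>" and \<alpha>: "0 < \<alpha>" "\<alpha> < 1"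
  shows "\<exists>K n0. 1 \<le> K \<and> (\<forall>n u w m. n0 \<le> real n \<longrightarrow> 2 * s \<le> u \<longrightarrow> u \<le> n \<longrightarrow>
     \<mu> * real n ^ s / real u ^ (s - 1) - 1 \<le> real m \<longrightarrow> K * real u < real w \<longrightarrow> real w \<le> (1 - \<alpha>) * real n \<longrightarrow>
     measure_pmf.prob (random_graph n m (s + h)) {G. card (wet m (s + h) s {1..u} G) = w} \<le> exp (- (L * real w)))"
proof -
  define N where "N = real ((s + h) choose s)"
  \<comment> \<open>\<open>(\<alpha> / 4) ^ h\<close> bounds the difference of falling factorials,
    \<open>2 ^ s\<close> pays for \<open>ffact w s \<ge> (w / 2) ^ s\<close>, and one more 2 for
    rounding \<open>m\<close>. \<open>K\<close> is chosen to give
    \<open>c0 * K \<ge> L + 1\<close>.\<close>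
  define c0 where "c0 = \<mu> * N * (\<alpha> / 4) ^ h / 2 ^ (s + 1)"
  define K where "K = max 1 ((L + 1) / c0)"
  define n0 where "n0 = max (real (s + h)) (max (2 / \<mu>) (4 * real h / \<alpha>))"
  have "0 < N" by (simp add: N_def)
  then have c0: "0 < c0" using \<mu> \<alpha> by (simp add: c0_def)
  have "(L + 1) / c0 \<le> K" by (simp add: K_def)
  then have K: "1 \<le> K" "L + 1 \<le> c0 * K"
    using c0 by (simp add: K_def, simp add: divide_le_eq mult.commute)
  show ?thesis
  proof (rule exI[of _ K], rule exI[of _ n0], intro conjI K(1) allI impI)
    fix n u w m :: nat
    assume n: "n0 \<le> real n" and us: "2 * s \<le> u" and un: "u \<le> n"
      and m: "\<mu> * real n ^ s / real u ^ (s - 1) - 1 \<le> real m"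
      and wK: "K * real u < real w" and wn: "real w \<le> (1 - \<alpha>) * real n"
    have nn: "s + h \<le> n" "2 / \<mu> \<le> real n" "4 * real h / \<alpha> \<le> real n"
      using n by (auto simp: n0_def)
    have n\<mu>: "2 \<le> \<mu> * real n" using nn(2) \<mu> by (simp add: field_simps)
    have nh: "4 * real h \<le> \<alpha> * real n" using nn(3) \<alpha> by (simp add: field_simps)
    have npos: "0 < real n" using nn(1) s by simp
    have upos: "0 < real u" using us s by simp
    define p where "p = nat \<lceil>(1 - \<alpha> / 2) * real n\<rceil>"
    have "real p = of_int \<lceil>(1 - \<alpha> / 2) * real n\<rceil>" using \<alpha> by (simp add: p_def)
    then have p: "(1 - \<alpha> / 2) * real n \<le> real p" "real p \<le> (1 - \<alpha> / 2) * real n + 1" by linarith+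
    have "(1 - \<alpha> / 2) * real n \<le> real n" using \<alpha> by (simp add: mult_left_le_one_le)
    then have "\<lceil>(1 - \<alpha> / 2) * real n\<rceil> \<le> int n" by (simp add: ceiling_le_iff)
    then have pn: "p \<le> n" unfolding p_def by linarith
    have pw: "\<alpha> / 2 * real n \<le> real p - real w" using p(1) wn by (simp add: algebra_simps)
    have an: "0 < \<alpha> / 2 * real n" using \<alpha> npos by simp
    have wp: "w < p" using pw an by linarith
    have "1 * real u \<le> K * real u" using K(1) by (intro mult_right_mono) auto
    then have uw: "u \<le> w" using wK by linarith
    have ratio: "real (n - w) / real (p - w) \<le> 2"
    proof -
      have "real n - real w \<le> 2 * (real p - real w)" using pw p(1) by (simp add: algebra_simps)
      then show ?thesis using wp pn by (simp add: divide_le_eq of_nat_diff)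
    qed
    define Q where "Q = real (ffact (n - w) h) - real (ffact (p - w) h)"
    have Q: "(\<alpha> / 4) ^ h * real n ^ h \<le> Q"
    proof -
      obtain j where j: "h = Suc j" using h gr0_implies_Suc by blast
      have "\<alpha> / 4 * real n \<le> real ((n - w) - (p - w))"
      proof -
        \<comment> \<open>Rounding \<open>p\<close> up loses at most 1, covered by half of the gap
          \<open>\<alpha> / 2 * n\<close>.\<close>
        have "1 \<le> \<alpha> / 4 * real n" using nh h by simp
        moreover have "real ((n - w) - (p - w)) = real n - real p" using wp pn by (simp add: of_nat_diff)
        ultimately show ?thesis using p(2) by (simp add: algebra_simps)
      qed
      moreover have "(\<alpha> / 4 * real n) ^ j \<le> real (ffact (n - w - 1) j)"
      proof -
        have "real w \<le> real n - \<alpha> * real n" using wn by (simp add: algebra_simps)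
        moreover have "1 + real j \<le> \<alpha> / 4 * real n" using nh j by simp
        ultimately have "\<alpha> / 4 * real n \<le> real n - real w - 1 - real j" using nh j by linarith
        also have "\<dots> \<le> real (n - w - 1 - j)" by linarith
        finally have "(\<alpha> / 4 * real n) ^ j \<le> real (n - w - 1 - j) ^ j"
          using \<alpha> by (intro power_mono) auto
        also have "\<dots> \<le> real (ffact (n - w - 1) j)"
          using power_le_ffact[of "n - w - 1" j] by (simp flip: of_nat_power)
        finally show ?thesis .
      qed
      ultimately have "(\<alpha> / 4 * real n) * (\<alpha> / 4 * real n) ^ j
          \<le> real ((n - w) - (p - w)) * real (ffact (n - w - 1) j)"
        using \<alpha> by (intro mult_mono) auto
      also have "\<dots> \<le> Q"
        unfolding Q_def j using wp pn by (intro ffact_diff_ge) auto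
      finally show ?thesis by (simp only: j flip: power_mult_distrib power_Suc)
    qed
    have W: "(real w / 2) ^ s \<le> real (ffact w s)"
    proof -
      have "real w / 2 \<le> real (w - s)" using us uw by linarith
      then have "(real w / 2) ^ s \<le> real (w - s) ^ s" by (intro power_mono) auto
      also have "\<dots> \<le> real (ffact w s)" using power_le_ffact[of w s] by (simp flip: of_nat_power)
      finally show ?thesis .
    qed
    have M: "\<mu> * real n ^ s / real u ^ (s - 1) / 2 \<le> real m"
    proof -
      have "real n * real u ^ (s - 1) \<le> real n * real n ^ (s - 1)"
        using un by (intro mult_left_mono power_mono) auto
      also have "\<dots> = real n ^ s" using s by (simp flip: power_Suc)
      finally have "real n \<le> real n ^ s / real u ^ (s - 1)" using upos by (simp add: field_simps)
      then have "\<mu> * real n \<le> \<mu> * (real n ^ s / real u ^ (s - 1))"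
        using \<mu> by (intro mult_left_mono) auto
      then have "2 \<le> \<mu> * real n ^ s / real u ^ (s - 1)" using n\<mu> by simp
      moreover have "y / 2 \<le> real m" if "2 \<le> y" "y - 1 \<le> real m" for y
        using that by simp
      ultimately show ?thesis using m by blast
    qed
    \<comment> \<open>The extra 1 in \<open>L + 1\<close> pays for the factor \<open>exp w\<close>
      from averaging.\<close>
    have expo: "(L + 1) * real w \<le> real m * (N * real (ffact w s) * Q) / real n ^ (s + h)"
    proof -
      have "(L + 1) * real w \<le> c0 * K * real w" using K by (intro mult_right_mono) auto
      also have "\<dots> \<le> c0 * (real w / real u) ^ (s - 1) * real w"
      proof -
        have Ku: "K \<le> real w / real u" using wK upos by (simp add: field_simps)
        then have "K \<le> (real w / real u) ^ 1" by simp
        also have "\<dots> \<le> (real w / real u) ^ (s - 1)" using Ku K s by (intro power_increasing) auto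
        finally show ?thesis using c0 by (intro mult_right_mono mult_left_mono) auto
      qed
      also have "\<dots> = (\<mu> * real n ^ s / real u ^ (s - 1) / 2) * (N * (real w / 2) ^ s * ((\<alpha> / 4) ^ h * real n ^ h)) / real n ^ (s + h)"
      proof -
        obtain j where "s = Suc j" using s by (cases s) auto
        then show ?thesis using npos upos
          by (simp add: c0_def power_divide power_add field_simps)
      qed
      also have "\<dots> \<le> real m * (N * real (ffact w s) * Q) / real n ^ (s + h)"
        using M W Q \<mu> \<open>0 < N\<close> \<alpha> by (intro divide_right_mono mult_mono mult_nonneg_nonneg) auto
      finally show ?thesis .
    qed
    have "measure_pmf.prob (random_graph n m (s + h)) {G. card (wet m (s + h) s {1..u} G) = w} \<le>
       (real (n - w) / real (p - w)) ^ (w - u) *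
       exp (- (real m * (real ((s + h) choose s) * real (ffact w s) *
       (real (ffact (n - w) (s + h - s)) - real (ffact (p - w) (s + h - s)))) / real n ^ (s + h)))"
      by (rule prob_card_wet_le) (use un uw wp pn nn in auto)
    also have "\<dots> \<le> exp 1 ^ w * exp (- ((L + 1) * real w))"
    proof (rule mult_mono)
      have "(real (n - w) / real (p - w)) ^ (w - u) \<le> exp 1 ^ (w - u)"
        using ratio exp_ge_add_one_self[of 1] by (intro power_mono) auto
      also have "\<dots> \<le> exp 1 ^ w" by (intro power_increasing) auto
      finally show "(real (n - w) / real (p - w)) ^ (w - u) \<le> exp 1 ^ w" .
    qed (use expo in \<open>auto simp: N_def Q_def\<close>)
    also have "\<dots> = exp (- (L * real w))"
      by (simp add: algebra_simps flip: exp_add exp_of_nat_mult)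
    finally show "measure_pmf.prob (random_graph n m (s + h)) {G. card (wet m (s + h) s {1..u} G) = w} \<le> exp (- (L * real w))" .
  qed
qed

section \<open>The rate function\<close>

text \<open>A real \<open>INF\<close> is informative only for sets bounded below. For
  \<open>lam < 0\<close> the exponential term and \<open>- lam * \<tau>\<close> are nonnegative,
  which leaves the stated bound.\<close>

lemma bdd_below_phi:
  assumes "0 \<le> \<mu>" "0 \<le> \<tau>"
  shows "bdd_below ((\<lambda>lam. phi k r \<mu> lam \<tau>) ` {..<0})"
    and "lam < 0 \<Longrightarrow> - (\<mu> * real (k choose (r - 1)) * (1 + \<tau>) ^ (r - 1)) \<le> phi k r \<mu> lam \<tau>"
proof -
  show *: "- (\<mu> * real (k choose (r - 1)) * (1 + \<tau>) ^ (r - 1)) \<le> phi k r \<mu> lam \<tau>" if "lam < 0" for lam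
  proof -
    let ?D = "\<mu> * real (k choose (r - 1)) * (1 + \<tau>) ^ (r - 1)"
    have "0 \<le> ?D * exp (real (k - r + 1) * lam) + (- lam) * \<tau>"
      using assms that by (intro add_nonneg_nonneg mult_nonneg_nonneg) auto
    then show ?thesis by (simp add: phi_def algebra_simps)
  qed
  show "bdd_below ((\<lambda>lam. phi k r \<mu> lam \<tau>) ` {..<0})"
    using * by (intro bdd_belowI2) auto
qed

text \<open>Taking \<open>lam = - 1 / \<tau>\<close> makes the linear term exactly 1, and the other
  term is nonpositive.\<close>

lemma bdd_above_INF_phi:
  assumes "0 \<le> \<mu>"
  shows "bdd_above ((\<lambda>\<tau>. INF lam\<in>{..<0}. phi k r \<mu> lam \<tau>) ` {0<..})"
proof (rule bdd_aboveI2)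
  fix \<tau> :: real assume \<tau>: "\<tau> \<in> {0<..}"
  let ?D = "\<mu> * real (k choose (r - 1)) * (1 + \<tau>) ^ (r - 1)"
  have "(INF lam\<in>{..<0}. phi k r \<mu> lam \<tau>) \<le> phi k r \<mu> (- 1 / \<tau>) \<tau>"
    using \<tau> assms bdd_below_phi by (intro cINF_lower) auto
  also have "\<dots> = ?D * (exp (- (real (k - r + 1) / \<tau>)) - 1) + 1"
    using \<tau> by (simp add: phi_def mult_ac)
  also have "\<dots> \<le> 1"
    using \<tau> assms by (simp add: mult_nonneg_nonpos)
  finally show "(INF lam\<in>{..<0}. phi k r \<mu> lam \<tau>) \<le> 1" .
qed

lemma INF_phi_le_SUP:
  assumes "0 \<le> \<mu>" "0 < \<tau>"
  shows "(INF lam\<in>{..<0}. phi k r \<mu> lam \<tau>) \<le> (SUP \<tau>\<in>{0<..}. INF lam\<in>{..<0}. phi k r \<mu> lam \<tau>)"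
  using assms bdd_above_INF_phi by (intro cSUP_upper) auto

text \<open>Let \<open>\<tau>\<close> tend to 0 from the right in \<open>bdd_below_phi\<close>; the
  supremum omits \<open>\<tau> = 0\<close> itself. This serves to compare decay rates with the
  supremum for \<open>\<tau> = 0\<close> and for large closures.\<close>

lemma SUP_INF_phi_ge:
  assumes "0 \<le> \<mu>"
  shows "- (\<mu> * real (k choose (r - 1))) \<le> (SUP \<tau>\<in>{0<..}. INF lam\<in>{..<0}. phi k r \<mu> lam \<tau>)"
    (is "_ \<le> ?S")
proof (rule tendsto_upperbound[of "\<lambda>\<tau>. - (\<mu> * real (k choose (r - 1)) * (1 + \<tau>) ^ (r - 1))" _ "at_right 0"])
  have "((\<lambda>\<tau>. - (\<mu> * real (k choose (r - 1)) * (1 + \<tau>) ^ (r - 1))) \<longlongrightarrow>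
      - (\<mu> * real (k choose (r - 1)) * (1 + 0) ^ (r - 1))) (at_right 0)"
    by (intro tendsto_intros)
  then show "((\<lambda>\<tau>. - (\<mu> * real (k choose (r - 1)) * (1 + \<tau>) ^ (r - 1))) \<longlongrightarrow>
      - (\<mu> * real (k choose (r - 1)))) (at_right 0)" by simp
  show "\<forall>\<^sub>F \<tau> in at_right 0. - (\<mu> * real (k choose (r - 1)) * (1 + \<tau>) ^ (r - 1)) \<le> ?S"
    using eventually_at_right_less[of "0 :: real"]
  proof (rule eventually_mono)
    fix \<tau> :: real assume \<tau>: "0 < \<tau>"
    have "- (\<mu> * real (k choose (r - 1)) * (1 + \<tau>) ^ (r - 1)) \<le> (INF lam\<in>{..<0}. phi k r \<mu> lam \<tau>)"
      using assms \<tau> bdd_below_phi(2) by (intro cINF_greatest) auto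
    also have "\<dots> \<le> ?S" using assms \<tau> by (rule INF_phi_le_SUP)
    finally show "- (\<mu> * real (k choose (r - 1)) * (1 + \<tau>) ^ (r - 1)) \<le> ?S" .
  qed
qed auto

section \<open>Summation over the closure sizes\<close>

lemma sum_half_powers_le:
  assumes "finite I"
  shows "(\<Sum>w\<in>I. (1 / 2 :: real) ^ w) \<le> 2"
proof -
  have "(\<Sum>w\<in>I. (1 / 2 :: real) ^ w) \<le> (\<Sum>w. (1 / 2 :: real) ^ w)"
    using assms by (intro sum_le_suminf summable_geometric) auto
  also have "\<dots> = 2" by (subst suminf_geometric) auto
  finally show ?thesis .
qed

text \<open>A bound \<open>exp (u * phi lam \<tau>)\<close> for every \<open>lam\<close> gives \<open>exp (u * S)\<close>, where \<open>S\<close> is the supremum: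
  for \<open>\<tau> > 0\<close> by the definition of \<open>S\<close>, for \<open>\<tau> = 0\<close> by letting \<open>lam\<close> be of order \<open>- ln u\<close>.\<close>
lemma le_exp_SUP_INF_phi:
  fixes P u E \<mu> \<tau> :: real
  assumes \<mu>: "0 \<le> \<mu>" and u: "1 \<le> u" and \<tau>: "0 \<le> \<tau>"
    and P: "\<And>lam. lam < 0 \<Longrightarrow> P \<le> exp (u * phi k r \<mu> lam \<tau> + E)"
  shows "P \<le> exp (u * (SUP \<tau>\<in>{0<..}. INF lam\<in>{..<0}. phi k r \<mu> lam \<tau>)
    + (\<mu> * real (k choose (r - 1)) + E))"
proof (cases "0 < P")
  case False
  then show ?thesis by (meson exp_gt_zero le_less_trans less_imp_le not_less)
next
  case True
  let ?D = "\<mu> * real (k choose (r - 1))"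
  let ?S = "SUP \<tau>\<in>{0<..}. INF lam\<in>{..<0}. phi k r \<mu> lam \<tau>"
  have D: "0 \<le> ?D" using \<mu> by simp
  have lnP: "ln P \<le> u * phi k r \<mu> lam \<tau> + E" if "lam < 0" for lam
    using P[OF that] True by (metis ln_exp ln_le_cancel_iff exp_gt_zero)
  have "ln P \<le> u * ?S + (?D + E)"
  proof (cases "\<tau> = 0")
    case False
    have "(ln P - E) / u \<le> (INF lam\<in>{..<0}. phi k r \<mu> lam \<tau>)"
    proof (rule cINF_greatest)
      fix lam :: real assume "lam \<in> {..<0}"
      then show "(ln P - E) / u \<le> phi k r \<mu> lam \<tau>"
        using lnP[of lam] u by (simp add: field_simps)
    qed auto
    also have "\<dots> \<le> ?S" using False \<tau> \<mu> by (intro INF_phi_le_SUP) auto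
    finally show ?thesis using u D by (simp add: field_simps)
  next
    case True
    \<comment> \<open>This gives \<open>u * exp ((k - r + 1) * lam) \<le> 1\<close>; the
      \<open>- 1\<close> keeps \<open>lam\<close> negative when \<open>u = 1\<close>.\<close>
    define lam where "lam = - ln u - 1"
    have lnu: "0 \<le> ln u" using u by simp
    then have lam: "lam < 0" by (simp add: lam_def)
    have "real (k - r + 1) * lam \<le> 1 * lam"
      using lam by (intro mult_right_mono_neg) auto
    also have "\<dots> \<le> - ln u" by (simp add: lam_def)
    finally have "exp (real (k - r + 1) * lam) \<le> exp (- ln u)" by simp
    then have "u * exp (real (k - r + 1) * lam) \<le> u * (1 / u)"
      using u by (intro mult_left_mono) (auto simp: exp_minus field_simps)
    then have e: "u * exp (real (k - r + 1) * lam) \<le> 1" using u by simp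
    have "u * phi k r \<mu> lam \<tau> = ?D * (u * exp (real (k - r + 1) * lam)) - u * ?D"
      using True by (simp add: phi_def algebra_simps)
    also have "\<dots> \<le> ?D - u * ?D" using mult_left_mono[OF e D] by simp
    finally have "u * phi k r \<mu> lam \<tau> \<le> ?D - u * ?D" .
    moreover have "- (u * ?D) \<le> u * ?S"
      using mult_left_mono[OF SUP_INF_phi_ge[OF \<mu>, of k r], of u] u by simp
    ultimately show ?thesis using lnP[OF lam] by linarith
  qed
  then show ?thesis using True by (metis exp_ln exp_le_cancel_iff)
qed

theorem mainTheorem7:
  fixes k r :: nat and u :: "nat \<Rightarrow> nat" and \<alpha> \<mu> :: real
  assumes "3 \<le> r" and "r \<le> k"
    and "filterlim u at_top sequentially"
    and "(\<lambda>n. real (u n) / real n) \<longlonglongrightarrow> 0"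
    and "0 < \<alpha>" and "\<alpha> < 1"
    and "\<mu> > mu_c k r"
  shows "\<exists>C. \<forall>\<^sub>F n in sequentially.
    measure_pmf.prob
      (random_graph n (nat \<lfloor>\<mu> * real n ^ (r - 1) / real (u n) ^ (r - 2)\<rfloor>) k)
      {G. \<not> (\<exists>V. V \<subseteq> {u n + 1..n} \<and>
              large_stopping_set n (nat \<lfloor>\<mu> * real n ^ (r - 1) / real (u n) ^ (r - 2)\<rfloor>) k G \<alpha> (k - r + 2) V)}
    \<ge> 1 - exp ((SUP \<tau>\<in>{0<..}. INF lam\<in>{..<0}. phi k r \<mu> lam \<tau>) * real (u n)
               + C * max (real (u n) ^ 2 / real n) (ln (real (u n))))"
proof -
  define s where "s = r - 1"
  define h where "h = k - r + 1"
  have s: "2 \<le> s" "0 < s" and h: "0 < h" and k: "k = s + h"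
    using assms(1,2) by (auto simp: s_def h_def)
  have sr: "r - 1 = s" "r - 2 = s - 1" "k - r + 1 = h" by (auto simp: s_def h_def)
  have "0 \<le> mu_c k r" by (simp add: mu_c_def)
  then have \<mu>: "0 < \<mu>" using assms(7) by linarith
  define D where "D = \<mu> * real (k choose s)"
  define S where "S = (SUP \<tau>\<in>{0<..}. INF lam\<in>{..<0}. phi k r \<mu> lam \<tau>)"
  have D0: "0 \<le> D" using \<mu> by (simp add: D_def)
  have DS: "- D \<le> S" using SUP_INF_phi_ge[of \<mu> k r] \<mu> unfolding D_def S_def sr by simp
  define m where "m n = nat \<lfloor>\<mu> * real n ^ (r - 1) / real (u n) ^ (r - 2)\<rfloor>" for n
  have m: "\<mu> * real n ^ s / real (u n) ^ (s - 1) - 1 \<le> real (m n)" for n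
    unfolding m_def sr by linarith
  \<comment> \<open>With rate \<open>D + 1\<close>, the part \<open>exp (- (D * w))\<close> is at
    most \<open>exp (u * S)\<close> because \<open>S \<ge> - D\<close> and \<open>w \<ge> u\<close>,
    and the remaining \<open>exp (- w)\<close> is summable.\<close>
  obtain K n0 where K: "1 \<le> K" and far: "\<And>n u w m. n0 \<le> real n \<Longrightarrow> 2 * s \<le> u \<Longrightarrow> u \<le> n \<Longrightarrow>
     \<mu> * real n ^ s / real u ^ (s - 1) - 1 \<le> real m \<Longrightarrow> K * real u < real w \<Longrightarrow> real w \<le> (1 - \<alpha>) * real n \<Longrightarrow>
     measure_pmf.prob (random_graph n m (s + h)) {G. card (wet m (s + h) s {1..u} G) = w} \<le> exp (- ((D + 1) * real w))"
    using prob_card_wet_far_le[OF s(1) h \<mu> assms(5,6), of "D + 1"] by blast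
  have K0: "0 \<le> K" using K by simp
  obtain B where B: "0 \<le> B" and near: "\<And>n u t m lam. 0 < u \<Longrightarrow> 2 * (1 + K) * real u \<le> real n \<Longrightarrow> s + h \<le> n \<Longrightarrow>
     real t \<le> K * real u \<Longrightarrow> \<mu> * real n ^ s / real u ^ (s - 1) - 1 \<le> real m \<Longrightarrow> lam < 0 \<Longrightarrow>
     measure_pmf.prob (random_graph n m (s + h)) {G. card (wet m (s + h) s {1..u} G) = u + t} \<le>
     exp (real u * (\<mu> * real ((s + h) choose s) * (1 + real t / real u) ^ s * (exp (real h * lam) - 1) - lam * (real t / real u))
       + B * (real u ^ 2 / real n + 1))"
    using prob_card_wet_near_le[OF s(2) h \<mu> K0] by blast
  \<comment> \<open>\<open>ln (K + 3) + 1\<close> accounts for the prefactor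
    \<open>(K + 3) * u\<close>, with 1 as the coefficient of \<open>ln u\<close>; \<open>D\<close>
    and \<open>2 * B\<close> come from the bound on each term, as \<open>q + 1\<close> is at most
    twice the maximum.\<close>
  define C where "C = ln (K + 3) + 1 + D + 2 * B"
  have "\<forall>\<^sub>F n in sequentially. real (u n) / real n < 1 / (2 * (1 + K))"
    using assms(4) K by (intro order_tendstoD) auto
  moreover have "\<forall>\<^sub>F n in sequentially. max (2 * s) 3 \<le> u n"
    using assms(3) unfolding filterlim_at_top by blast
  moreover have "\<forall>\<^sub>F n in sequentially. max (nat \<lceil>n0\<rceil>) (s + h) \<le> n"
    by (rule eventually_ge_at_top)
  ultimately have "\<forall>\<^sub>F n in sequentially.
    measure_pmf.prob (random_graph n (m n) k)
      {G. \<not> (\<exists>V. V \<subseteq> {u n + 1..n} \<and> large_stopping_set n (m n) k G \<alpha> (k - r + 2) V)}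
    \<ge> 1 - exp (S * real (u n) + C * max (real (u n) ^ 2 / real n) (ln (real (u n))))"
  proof eventually_elim
    case (elim n)
    have n: "n0 \<le> real n" "s + h \<le> n" using elim(3) by (auto simp: nat_le_iff ceiling_le_iff)
    have us: "2 * s \<le> u n" "3 \<le> u n" using elim(2) by auto
    have npos: "0 < real n" using n(2) h by simp
    have un: "2 * (1 + K) * real (u n) \<le> real n"
      using elim(1) npos K by (simp add: field_simps)
    have "real (u n) \<le> 2 * (1 + K) * real (u n)" using K by (simp add: algebra_simps)
    then have unn: "u n \<le> n" using un by linarith
    \<comment> \<open>Hence the maximum in the error term is at least 1 and absorbs
      constants.\<close>
    have lnu: "1 \<le> ln (real (u n))"
    proof -
      have "exp 1 \<le> real (u n)" using us exp_le by linarith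
      then show ?thesis using us by (simp add: ln_ge_iff)
    qed
    define q where "q = real (u n) ^ 2 / real n"
    define P where "P w = measure_pmf.prob (random_graph n (m n) k) {G. card (wet (m n) k s {1..u n} G) = w}" for w
    let ?I = "{w. u n \<le> w \<and> real w \<le> (1 - \<alpha>) * real n}"
    let ?I1 = "{w \<in> ?I. real w \<le> K * real (u n)}" and ?I2 = "{w \<in> ?I. K * real (u n) < real w}"
    have finI: "finite ?I"
      by (rule finite_subset[of _ "{..nat \<lfloor>(1 - \<alpha>) * real n\<rfloor>}"]) (auto simp: le_nat_floor)
    then have finI12: "finite ?I1" "finite ?I2" by (auto intro: finite_subset[of _ ?I])
    have P1: "P w \<le> exp (real (u n) * S + (D + B * (q + 1)))" if w: "w \<in> ?I1" for w
    proof -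
      define t where "t = w - u n"
      have wt: "w = u n + t" and t: "real t \<le> K * real (u n)" using w by (auto simp: t_def)
      have "P w \<le> exp (real (u n) * (SUP \<tau>\<in>{0<..}. INF lam\<in>{..<0}. phi k r \<mu> lam \<tau>)
        + (\<mu> * real (k choose (r - 1)) + B * (q + 1)))"
      proof (rule le_exp_SUP_INF_phi)
        fix lam :: real assume lam: "lam < 0"
        have "P w \<le> exp (real (u n) * (\<mu> * real ((s + h) choose s) * (1 + real t / real (u n)) ^ s * (exp (real h * lam) - 1) - lam * (real t / real (u n)))
             + B * (q + 1))"
          unfolding P_def wt k q_def using us un n(2) t m lam by (intro near) auto
        then show "P w \<le> exp (real (u n) * phi k r \<mu> lam (real t / real (u n)) + B * (q + 1))"
          unfolding phi_def sr unfolding k by (simp only: mult_ac)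
      qed (use \<mu> us in auto)
      then show ?thesis unfolding S_def D_def sr .
    qed
    have P2: "P w \<le> exp (real (u n) * S) * (1 / 2) ^ w" if w: "w \<in> ?I2" for w
    proof -
      have "P w \<le> exp (- ((D + 1) * real w))"
        unfolding P_def k using n(1) us unn m w by (intro far) auto
      also have "\<dots> = exp (- (D * real w)) * exp (- 1) ^ w"
        by (simp add: algebra_simps flip: exp_add exp_of_nat_mult)
      also have "\<dots> \<le> exp (real (u n) * S) * (1 / 2) ^ w"
      proof (intro mult_mono power_mono)
        have "- (D * real w) \<le> - (D * real (u n))" using w D0 by (simp add: mult_left_mono)
        also have "\<dots> \<le> real (u n) * S" using mult_left_mono[OF DS, of "real (u n)"] by (simp add: mult.commute)
        finally show "exp (- (D * real w)) \<le> exp (real (u n) * S)" by simp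
        show "exp (- 1) \<le> (1 / 2 :: real)"
          using exp_ge_add_one_self[of 1] by (simp add: exp_minus field_simps)
      qed auto
      finally show ?thesis .
    qed
    have cI1: "real (card ?I1) \<le> K * real (u n) + 1"
    proof -
      have "?I1 \<subseteq> {..nat \<lfloor>K * real (u n)\<rfloor>}" by (auto simp: le_nat_floor)
      then have "card ?I1 \<le> Suc (nat \<lfloor>K * real (u n)\<rfloor>)"
        using card_mono[of "{..nat \<lfloor>K * real (u n)\<rfloor>}" ?I1] by simp
      moreover have "0 \<le> K * real (u n)" using K by simp
      ultimately show ?thesis by linarith
    qed
    have q0: "0 \<le> q" by (simp add: q_def)
    \<comment> \<open>Up to \<open>K * u\<close> there are at most \<open>K * u + 1\<close> terms
      with a common bound; beyond it the terms decay geometrically and contribute at most twice that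
      bound.\<close>
    have "(\<Sum>w\<in>?I. P w) = (\<Sum>w\<in>?I1 \<union> ?I2. P w)" by (rule sum.cong) auto
    also have "\<dots> = (\<Sum>w\<in>?I1. P w) + (\<Sum>w\<in>?I2. P w)"
      using finI12 by (intro sum.union_disjoint) auto
    also have "(\<Sum>w\<in>?I1. P w) \<le> real (card ?I1) * exp (real (u n) * S + (D + B * (q + 1)))"
      by (rule sum_bounded_above[OF P1])
    also have "\<dots> \<le> (K * real (u n) + 1) * exp (real (u n) * S + (D + B * (q + 1)))"
      using cI1 by (intro mult_right_mono) auto
    also have "(\<Sum>w\<in>?I2. P w) \<le> (\<Sum>w\<in>?I2. exp (real (u n) * S) * (1 / 2) ^ w)"
      by (rule sum_mono[OF P2])
    also have "\<dots> = exp (real (u n) * S) * (\<Sum>w\<in>?I2. (1 / 2) ^ w)" by (rule sum_distrib_left[symmetric])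
    also have "\<dots> \<le> exp (real (u n) * S + (D + B * (q + 1))) * 2"
      using finI12 D0 B q0 by (intro mult_mono sum_half_powers_le) (auto intro: sum_nonneg)
    finally have "(\<Sum>w\<in>?I. P w) \<le> (K * real (u n) + 3) * exp (real (u n) * S + (D + B * (q + 1)))"
      by (simp add: algebra_simps)
    also have "\<dots> \<le> exp (ln (K + 3) + ln (real (u n))) * exp (real (u n) * S + (D + B * (q + 1)))"
    proof (rule mult_right_mono)
      have "K * real (u n) + 3 \<le> (K + 3) * real (u n)" using us by (simp add: algebra_simps)
      also have "\<dots> = exp (ln (K + 3) + ln (real (u n)))" using K us by (simp add: exp_add)
      finally show "K * real (u n) + 3 \<le> exp (ln (K + 3) + ln (real (u n)))" .
    qed auto
    also have "\<dots> \<le> exp (S * real (u n) + C * max q (ln (real (u n))))"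
    proof -
      define M where "M = max q (ln (real (u n)))"
      have M: "1 \<le> M" "q \<le> M" "ln (real (u n)) \<le> M" using lnu by (auto simp: M_def)
      have "0 \<le> ln (K + 3)" using K by simp
      then have "ln (K + 3) * 1 \<le> ln (K + 3) * M" using M by (intro mult_left_mono)
      moreover have "D * 1 \<le> D * M" using M D0 by (intro mult_left_mono)
      moreover have "B * (q + 1) \<le> B * (M + M)" using M B by (intro mult_left_mono) auto
      ultimately have "ln (K + 3) + ln (real (u n)) + (D + B * (q + 1)) \<le> C * M"
        using M by (simp add: C_def algebra_simps)
      then show ?thesis unfolding M_def[symmetric] by (simp add: mult.commute flip: exp_add)
    qed
    finally have sum: "(\<Sum>w\<in>?I. P w) \<le> exp (S * real (u n) + C * max q (ln (real (u n))))" .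
    have "measure_pmf.prob (random_graph n (m n) k)
      {G. \<not> (\<exists>V. V \<subseteq> {u n + 1..n} \<and> large_stopping_set n (m n) k G \<alpha> (k - r + 2) V)} \<ge> 1 - (\<Sum>w\<in>?I. P w)"
      unfolding P_def sr(1)[symmetric] using assms(1,2) unn n k by (intro prob_no_large_stopping_set_ge) auto
    then show ?case using sum by (simp add: q_def)
  qed
  then show ?thesis unfolding S_def m_def by blast
qed

end
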